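(* Let $\{\boldsymbol{Y}_k : k = 0,1,2,\dots\}$ be a matrix martingale whose values are self-adjoint matrices of dimension $d$ (that is, $d\times d$), with $\boldsymbol{Y}_0=\boldsymbol{0}$, and let $\boldsymbol{X}_k = \boldsymbol{Y}_k - \boldsymbol{Y}_{k-1}$, $k=1,2,3,\dots$, be its difference sequence. Assume that for a real constant $R$, $$\lambda_{\max}(\boldsymbol{X}_k) \leq R \quad\text{almost surely, for } k=1,2,3,\dots.$$ Define the predictable quadratic variation process of the martingale by $$\boldsymbol{W}_k := \sum_{j=1}^k \mathbb{E}_{j-1}\big(\boldsymbol{X}_j^2\big)\quad\text{for } k=1,2,3,\dots,\qquad \boldsymbol{W}_0 := \boldsymbol{0}.$$ Then, for all $t\geq 0$ and $\sigma^2>0$, $$\mathbb{P}\left\{ \exists\, k\geq 0 : \lambda_{\max}(\boldsymbol{Y}_k)\geq t \ \text{ and }\ \|\boldsymbol{W}_k\|\leq \sigma^2 \right\} \leq d\cdot \exp\left\{ \frac{-t^2/2}{\sigma^2 + Rt/3}\right\}.$$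
   Context: Let $(\Omega,\mathscr{F},\mathbb{P})$ be a probability space with a filtration $\mathscr{F}_0\subset\mathscr{F}_1\subset\mathscr{F}_2\subset\dots\subset\mathscr{F}$; $\mathbb{E}_k$ denotes expectation conditioned on $\mathscr{F}_k$. Self-adjoint means Hermitian. $\lambda_{\max}$ denotes the algebraically largest eigenvalue of a self-adjoint matrix, and $\|\cdot\|$ denotes the spectral norm (largest singular value). A random process $\{\boldsymbol{Y}_k : k=0,1,2,\dots\}$ with values in matrices of a fixed finite dimension is a matrix martingale when it is adapted to the filtration, $\mathbb{E}_{k-1}\boldsymbol{Y}_k=\boldsymbol{Y}_{k-1}$ and $\mathbb{E}\|\boldsymbol{Y}_k\|<+\infty$ for $k=1,2,3,\dots$; throughout it is assumed that $\boldsymbol{Y}_0=\boldsymbol{0}$. The conditional expectations $\mathbb{E}_{j-1}(\boldsymbol{X}_j^2)$ used in the statement are assumed to exist. *)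

theory Defs
  imports "HOL-Probability.Probability"
begin

definition mat_adjoint :: "complex ^ 'n ^ 'm \<Rightarrow> complex ^ 'm ^ 'n" where
  "mat_adjoint A = (\<chi> i j. cnj (A $ j $ i))"

definition self_adjoint :: "complex ^ 'n ^ 'n \<Rightarrow> bool" where
  "self_adjoint A \<longleftrightarrow> mat_adjoint A = A"

definition is_eigenvalue :: "complex ^ 'n ^ 'n \<Rightarrow> complex \<Rightarrow> bool" where
  "is_eigenvalue A c \<longleftrightarrow> (\<exists>v. v \<noteq> 0 \<and> A *v v = c *s v)"

(* Intended for self-adjoint A, whose eigenvalues are all real and form a finite nonempty set. *)
definition lambda_max :: "complex ^ 'n ^ 'n \<Rightarrow> real" where
  "lambda_max A = Max {r. is_eigenvalue A (complex_of_real r)}"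

definition singular_values :: "complex ^ 'n ^ 'm \<Rightarrow> real set" where
  "singular_values A =
     {s. 0 \<le> s \<and> is_eigenvalue (mat_adjoint A ** A) (complex_of_real (s\<^sup>2))}"

(* Not the library's norm on complex ^ 'n ^ 'm, which is the Frobenius norm. *)
definition spectral_norm :: "complex ^ 'n ^ 'm \<Rightarrow> real" where
  "spectral_norm A = Max (singular_values A)"

definition mat_cond_exp ::
  "'a measure \<Rightarrow> 'a measure \<Rightarrow> ('a \<Rightarrow> complex ^ 'n ^ 'm) \<Rightarrow> 'a \<Rightarrow> complex ^ 'n ^ 'm" where
  "mat_cond_exp M G f \<omega> =
     (\<chi> i j. Complex (real_cond_exp M G (\<lambda>x. Re (f x $ i $ j)) \<omega>)
                    (real_cond_exp M G (\<lambda>x. Im (f x $ i $ j)) \<omega>))"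

(* The conditional expectation of a random matrix exists when, for each entry, the conditional
   expectation of its modulus (always defined in [0, \<infinity>]) is almost surely finite. This holds
   in particular for integrable f. The definition real_cond_exp, the difference of the conditional
   expectations of the positive and negative parts, then has its usual meaning; without such a
   condition it would silently replace infinite values by 0. *)
definition mat_cond_exp_exists ::
  "'a measure \<Rightarrow> 'a measure \<Rightarrow> ('a \<Rightarrow> complex ^ 'n ^ 'm) \<Rightarrow> bool" where
  "mat_cond_exp_exists M G f \<longleftrightarrow>
     (\<forall>i j. AE \<omega> in M. nn_cond_exp M G (\<lambda>x. ennreal (cmod (f x $ i $ j))) \<omega> < \<infinity>)"

definition matrix_martingale ::
  "'a measure \<Rightarrow> (nat \<Rightarrow> 'a measure) \<Rightarrow> (nat \<Rightarrow> 'a \<Rightarrow> complex ^ 'n ^ 'n) \<Rightarrow> bool" where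
  "matrix_martingale M F Y \<longleftrightarrow>
     (\<forall>k. Y k \<in> borel_measurable (F k)) \<and>
     (\<forall>k\<ge>1. AE \<omega> in M. mat_cond_exp M (F (k - 1)) (Y k) \<omega> = Y (k - 1) \<omega>) \<and>
     (\<forall>k\<ge>1. integrable M (\<lambda>\<omega>. spectral_norm (Y k \<omega>)))"

(* Only used for k \<ge> 1. *)
definition difference_seq ::
  "(nat \<Rightarrow> 'a \<Rightarrow> complex ^ 'n ^ 'n) \<Rightarrow> nat \<Rightarrow> 'a \<Rightarrow> complex ^ 'n ^ 'n" where
  "difference_seq Y k \<omega> = Y k \<omega> - Y (k - 1) \<omega>"

definition predictable_quad_var ::
  "'a measure \<Rightarrow> (nat \<Rightarrow> 'a measure) \<Rightarrow> (nat \<Rightarrow> 'a \<Rightarrow> complex ^ 'n ^ 'n) \<Rightarrow>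
     nat \<Rightarrow> 'a \<Rightarrow> complex ^ 'n ^ 'n" where
  "predictable_quad_var M F Y k \<omega> =
     (\<Sum>j=1..k. mat_cond_exp M (F (j - 1))
        (\<lambda>x. difference_seq Y j x ** difference_seq Y j x) \<omega>)"

end

theory Submission
  imports Defs
begin

text \<open>
  The process \<open>S\<^sub>k = tr exp (\<theta> Y\<^sub>k - g W\<^sub>k)\<close> with \<open>g = (\<theta>\<^sup>2/2) / (1 - \<theta>R/3)\<close> is a nonnegative supermartingale
  with \<open>S\<^sub>0 = d\<close>, and on the event in question it exceeds \<open>exp (\<theta>t - g\<sigma>\<^sup>2)\<close> at some time; the maximal
  inequality with \<open>\<theta> = t / (\<sigma>\<^sup>2 + Rt/3)\<close> gives the bound.

  The supermartingale property rests on Lieb's concavity theorem for \<open>A \<mapsto> tr exp (H + log A)\<close>, in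
  supporting-hyperplane form: for self-adjoint \<open>H\<close>, \<open>G\<close> there is \<open>M\<close> with
  \<open>tr exp (H + X) \<le> tr (M exp X)\<close> for all self-adjoint \<open>X\<close> and equality at \<open>X = G\<close>. Writing
  \<open>T = exp (H + X)\<close> and \<open>A = exp X\<close>, this is joint convexity of the relative entropy
  \<open>tr T (log T - log A)\<close>. The entropy is the integral over \<open>s > 0\<close> of the jointly convex functions
  \<open>\<langle>T, (L\<^sub>A + s R\<^sub>T)\<^sup>-\<^sup>1 T\<rangle> - tr T / (1 + s)\<close>, where \<open>L\<^sub>A\<close>, \<open>R\<^sub>T\<close> denote left and right multiplication; each is
  bounded below by its tangent, and all the integrals in \<open>s\<close> are explicit in eigenbases.

  Conditional expectations are never taken of a random functional \<open>M\<close>: \<open>\<Omega>\<close> is cut into countably many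
  \<open>F\<^sub>k\<close>-measurable cells on which \<open>\<theta> Y\<^sub>k - g W\<^sub>k\<close> and the conditional second moment are nearly constant,
  so that a deterministic \<open>M\<close> can be used on each cell.
\<close>

section \<open>Self-adjoint complex matrices and the spectral theorem\<close>

lemma mat_adjoint_nth [simp]: "mat_adjoint A $ i $ j = cnj (A $ j $ i)"
  by (simp add: mat_adjoint_def)

lemma mat_adjoint_mat_adjoint [simp]: "mat_adjoint (mat_adjoint A) = A"
  by (simp add: vec_eq_iff)

lemma mat_adjoint_mult: "mat_adjoint (A ** B) = mat_adjoint B ** mat_adjoint A"
  by (simp add: vec_eq_iff matrix_matrix_mult_def mult.commute)

lemma mat_adjoint_add: "mat_adjoint (A + B) = mat_adjoint A + mat_adjoint B"
  by (simp add: vec_eq_iff)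

lemma mat_adjoint_diff: "mat_adjoint (A - B) = mat_adjoint A - mat_adjoint B"
  by (simp add: vec_eq_iff)

lemma mat_adjoint_scaleR: "mat_adjoint (c *\<^sub>R A) = c *\<^sub>R mat_adjoint A"
  by (simp add: vec_eq_iff)

lemma mat_adjoint_mat_1 [simp]: "mat_adjoint (mat 1) = mat 1"
  by (simp add: vec_eq_iff mat_def)

lemma self_adjoint_add: "self_adjoint A \<Longrightarrow> self_adjoint B \<Longrightarrow> self_adjoint (A + B)"
  by (simp add: self_adjoint_def mat_adjoint_add)

lemma self_adjoint_diff: "self_adjoint A \<Longrightarrow> self_adjoint B \<Longrightarrow> self_adjoint (A - B)"
  by (simp add: self_adjoint_def mat_adjoint_diff)

lemma self_adjoint_scaleR: "self_adjoint A \<Longrightarrow> self_adjoint (c *\<^sub>R A)"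
  by (simp add: self_adjoint_def mat_adjoint_scaleR)

lemma self_adjoint_mat_1 [simp]: "self_adjoint (mat 1)"
  by (simp add: self_adjoint_def)

lemma self_adjoint_0 [simp]: "self_adjoint 0"
  by (simp add: self_adjoint_def vec_eq_iff)

lemma self_adjoint_square: "self_adjoint A \<Longrightarrow> self_adjoint (A ** A)"
  by (simp add: self_adjoint_def mat_adjoint_mult)

lemma self_adjoint_adjoint_mult: "self_adjoint (mat_adjoint A ** A)"
  by (simp add: self_adjoint_def mat_adjoint_mult)

lemma inner_complex_Re: "inner z w = Re (cnj z * w)" for z w :: complex
  by (simp add: inner_complex_def)

text \<open>On complex vectors \<open>inner\<close> is the real part of the Hermitian form, so the
  adjoint moves across it once the two sums are exchanged.\<close>

lemma inner_mat_adjoint: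
  fixes A :: "complex ^ 'n ^ 'm"
  shows "inner u (A *v v) = inner (mat_adjoint A *v u) v"
proof -
  have "inner u (A *v v) = Re (\<Sum>i\<in>UNIV. \<Sum>j\<in>UNIV. cnj (u $ i) * (A $ i $ j * v $ j))"
    by (simp add: inner_vec_def inner_complex_Re matrix_vector_mult_def sum_distrib_left)
  also have "(\<Sum>i\<in>UNIV. \<Sum>j\<in>UNIV. cnj (u $ i) * (A $ i $ j * v $ j))
      = (\<Sum>j\<in>UNIV. \<Sum>i\<in>UNIV. cnj (u $ i) * (A $ i $ j * v $ j))"
    by (rule sum.swap)
  also have "\<dots> = (\<Sum>j\<in>UNIV. cnj ((mat_adjoint A *v u) $ j) * v $ j)"
    by (simp add: matrix_vector_mult_def sum_distrib_left sum_distrib_right mult_ac)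
  finally show ?thesis
    by (simp add: inner_vec_def inner_complex_Re del: complex_cnj_cnj)
qed

lemma inner_self_adjoint: "self_adjoint A \<Longrightarrow> inner u (A *v v) = inner (A *v u) v"
  by (simp add: inner_mat_adjoint self_adjoint_def)

section \<open>Unitary diagonalisation of self-adjoint matrices\<close>

definition diag_mat :: "('n \<Rightarrow> real) \<Rightarrow> complex ^ 'n ^ 'n" where
  "diag_mat d = (\<chi> i j. if i = j then complex_of_real (d i) else 0)"

definition unitary :: "complex ^ 'n ^ 'n \<Rightarrow> bool" where
  "unitary U \<longleftrightarrow> mat_adjoint U ** U = mat 1"

lemma unitary_right: "unitary U \<Longrightarrow> U ** mat_adjoint U = mat 1"
  by (simp add: unitary_def matrix_left_right_inverse)

lemma unitary_cancel:
  assumes "unitary U"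
  shows "mat_adjoint U ** (U ** A) = A" "U ** (mat_adjoint U ** A) = A"
    "A ** U ** mat_adjoint U = A" "A ** mat_adjoint U ** U = A"
  using assms unitary_right[OF assms]
  by (simp_all add: matrix_mul_assoc unitary_def flip: matrix_mul_assoc[of A])

text \<open>The Hermitian form, conjugate linear on the left. Orthogonality for the real
  \<open>inner\<close> is weaker: vectors orthogonal only in that sense need not be the columns of a
  unitary matrix.\<close>

definition cinner :: "complex ^ 'n \<Rightarrow> complex ^ 'n \<Rightarrow> complex" where
  "cinner u v = (\<Sum>i\<in>UNIV. cnj (u $ i) * v $ i)"

text \<open>The imaginary part comes from rotating the first argument by the imaginary unit, so
  facts about \<open>inner\<close> carry over to the Hermitian form.\<close>

lemma cinner_eq: "cinner u v = Complex (inner u v) (inner (\<i> *s u) v)"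
  by (simp add: cinner_def complex_eq_iff inner_vec_def inner_complex_def)

lemma cinner_self_adjoint:
  assumes "self_adjoint A" shows "cinner u (A *v v) = cinner (A *v u) v"
  by (simp add: cinner_eq inner_self_adjoint[OF assms] vector_scalar_commute)

lemma mat_vec_mult_scaleR: "A *v (c *\<^sub>R v) = c *\<^sub>R (A *v v)" for A :: "complex ^ 'n ^ 'm"
  by (simp add: linear_scale)

text \<open>Rayleigh quotient: the orthogonal complement \<open>W\<close> of the known eigenvectors
  is nonzero, closed and invariant under \<open>A\<close>, so the quadratic form has a maximiser on
  its unit sphere, and the first-order condition makes that maximiser an eigenvector.\<close>

lemma exists_orthogonal_eigenvector:
  fixes A :: "complex ^ 'n ^ 'n" and u :: "'n \<Rightarrow> complex ^ 'n"
  assumes A: "self_adjoint A" and S: "S \<noteq> UNIV"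
    and eig: "\<And>k. k \<in> S \<Longrightarrow> A *v u k = d k *\<^sub>R u k"
  shows "\<exists>v c. norm v = 1 \<and> (\<forall>k\<in>S. cinner (u k) v = 0) \<and> A *v v = (c::real) *\<^sub>R v"
proof -
  define W where "W = {v. \<forall>k\<in>S. cinner (u k) v = 0}"
  have W_add: "x \<in> W \<Longrightarrow> y \<in> W \<Longrightarrow> x + y \<in> W" for x y
    by (simp add: W_def cinner_def distrib_left sum.distrib)
  have W_scale: "x \<in> W \<Longrightarrow> c *\<^sub>R x \<in> W" for x c
    by (auto simp: W_def cinner_eq complex_eq_iff)
  have W_A: "A *v x \<in> W" if "x \<in> W" for x
    using that by (simp add: W_def cinner_self_adjoint[OF A] eig)
      (simp add: cinner_def mult.assoc flip: sum_distrib_left scaleR_sum_right)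
  \<comment> \<open>One linear equation per index in \<open>S\<close>, padded with zero rows. An
    index outside \<open>S\<close> makes this square matrix singular, and a kernel vector is a
    nonzero element of \<open>W\<close>.\<close>
  define C :: "complex ^ 'n ^ 'n" where "C = (\<chi> k i. if k \<in> S then cnj (u k $ i) else 0)"
  obtain k0 where k0: "k0 \<notin> S" using S by auto
  have "row k0 C = 0" by (simp add: row_def C_def k0 vec_eq_iff)
  hence "det C = 0" by (rule det_zero_row(1))
  hence "\<not> invertible C" by (simp add: invertible_det_nz)
  then obtain x where x: "C *v x = 0" "x \<noteq> 0"
    using matrix_left_invertible_ker[of C] invertible_left_inverse[of C] by auto
  have xW: "x \<in> W"
    unfolding W_def
  proof safe
    fix k assume "k \<in> S"
    have "(C *v x) $ k = cinner (u k) x"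
      using \<open>k \<in> S\<close> by (simp add: matrix_vector_mult_def C_def cinner_def)
    thus "cinner (u k) x = 0" using x by simp
  qed
  define T where "T = W \<inter> sphere 0 1"
  have "closed W"
    unfolding W_def Ball_def cinner_def
    by (intro closed_Collect_all closed_Collect_imp closed_Collect_eq continuous_intros) auto
  hence "compact T" unfolding T_def by (simp add: closed_Int_compact)
  moreover have "(1 / norm x) *\<^sub>R x \<in> T"
    using W_scale[OF xW] x by (simp add: T_def)
  moreover have "continuous_on T (\<lambda>v. inner v (A *v v))"
    by (intro continuous_intros linear_continuous_on linear_linear[THEN iffD2] matrix_vector_mul_linear)
  ultimately obtain v where v: "v \<in> T" "\<And>w. w \<in> T \<Longrightarrow> inner w (A *v w) \<le> inner v (A *v v)"
    using continuous_attains_sup[of T "\<lambda>v. inner v (A *v v)"] by auto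
  have vW: "v \<in> W" and nv: "norm v = 1" using v by (auto simp: T_def)
  define c where "c = inner v (A *v v)"
  have bound: "inner w (A *v w) \<le> c * inner w w" if "w \<in> W" for w
  proof (cases "w = 0")
    case False
    have "(1 / norm w) *\<^sub>R w \<in> T" using W_scale[OF that] False by (simp add: T_def)
    from v(2)[OF this] False have "inner w (A *v w) / (norm w)\<^sup>2 \<le> c"
      by (simp add: c_def mat_vec_mult_scaleR power2_eq_square)
    with False show ?thesis
      by (simp add: divide_le_eq power2_norm_eq_inner)
  qed simp
  define r where "r = A *v v - c *\<^sub>R v"
  have rW: "r \<in> W"
    using W_add[OF W_A[OF vW] W_scale[OF vW, of "- c"]] by (simp add: r_def)
  \<comment> \<open>first-order condition for the maximiser \<open>v\<close>, tested in the direction of the residual \<open>r\<close>\<close>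
  have quad: "2 * e * inner r r \<le> e\<^sup>2 * (c * inner r r - inner r (A *v r))" for e
  proof -
    have "inner (v + e *\<^sub>R r) (A *v (v + e *\<^sub>R r)) \<le> c * inner (v + e *\<^sub>R r) (v + e *\<^sub>R r)"
      by (intro bound W_add vW W_scale rW)
    moreover have "inner v v = 1" using nv by (simp add: norm_eq_sqrt_inner)
    moreover have "inner v (A *v r) = inner (A *v v) r" by (rule inner_self_adjoint[OF A])
    moreover have "inner (A *v v) r = inner r r + c * inner v r"
      by (simp add: r_def inner_diff_left)
    ultimately show ?thesis
      using c_def
      by (simp add: matrix_vector_right_distrib mat_vec_mult_scaleR inner_add_left inner_add_right
          inner_commute[of r v] inner_commute[of r "A *v v"] algebra_simps power2_eq_square)
  qed
  have "inner r r = 0"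
  proof (rule ccontr)
    assume nz: "inner r r \<noteq> 0"
    define q where "q = c * inner r r - inner r (A *v r)"
    define N where "N = inner r r"
    have N: "N > 0" using nz by (simp add: N_def)
    \<comment> \<open>For this step size \<open>e * q\<close> is at most \<open>N\<close>, whereas
      \<open>quad\<close> divided by \<open>e\<close> demands at least \<open>2 * N\<close>.\<close>
    define e where "e = N / (\<bar>q\<bar> + 1)"
    have e: "e > 0" "e * (\<bar>q\<bar> + 1) = N" using N by (simp_all add: e_def field_simps)
    have "e * (2 * N) \<le> e * (e * q)"
      using quad[of e] by (simp add: N_def q_def power2_eq_square mult_ac)
    hence "2 * N \<le> e * q" using e by simp
    also have "\<dots> \<le> e * (\<bar>q\<bar> + 1)" using e by (intro mult_left_mono) auto
    finally have "2 * N \<le> N" using e by simp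
    with N show False by linarith
  qed
  hence "A *v v = c *\<^sub>R v" by (simp add: r_def)
  thus ?thesis using nv vW by (auto simp: W_def)
qed

text \<open>Induction over sets of indices: each new index receives a unit eigenvector orthogonal to
  the earlier ones, and the family over all indices supplies the columns of
  \<open>U\<close>.\<close>

lemma spectral_decomposition:
  fixes A :: "complex ^ 'n ^ 'n"
  assumes A: "self_adjoint A"
  obtains U d where "unitary U" "A = U ** diag_mat d ** mat_adjoint U"
proof -
  have "\<exists>u d. (\<forall>k\<in>S. A *v u k = (d k :: real) *\<^sub>R u k) \<and>
      (\<forall>k\<in>S. \<forall>l\<in>S. cinner (u k) (u l) = (if k = l then 1 else 0))" if "finite S" for S :: "'n set"
    using that
  proof (induction S rule: finite_induct)
    case (insert m S)
    then obtain u d where eig: "\<And>k. k \<in> S \<Longrightarrow> A *v u k = (d k :: real) *\<^sub>R u k"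
      and ort: "\<And>k l. k \<in> S \<Longrightarrow> l \<in> S \<Longrightarrow> cinner (u k) (u l) = (if k = l then 1 else 0)"
      by blast
    from insert have "S \<noteq> UNIV" by auto
    from exists_orthogonal_eigenvector[where u = u and d = d, OF A this eig]
    obtain v c where v: "norm v = 1" "\<And>k. k \<in> S \<Longrightarrow> cinner (u k) v = 0" "A *v v = (c::real) *\<^sub>R v"
      by blast
    have sym: "cinner v (u k) = 0" if "k \<in> S" for k
    proof -
      have "cinner v (u k) = cnj (cinner (u k) v)" by (simp add: cinner_def mult.commute)
      thus ?thesis using v(2)[OF that] by simp
    qed
    have "cinner v v = 1"
    proof -
      have "cinner v v = of_real (\<Sum>i\<in>UNIV. (cmod (v $ i))\<^sup>2)"
        by (simp add: cinner_def complex_norm_square mult.commute flip: of_real_power)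
      also have "(\<Sum>i\<in>UNIV. (cmod (v $ i))\<^sup>2) = (norm v)\<^sup>2"
        by (simp add: norm_vec_def L2_set_def sum_nonneg)
      finally show ?thesis using v(1) by simp
    qed
    with insert.hyps v eig ort sym show ?case
      by (intro exI[of _ "u(m := v)"] exI[of _ "d(m := c)"]) auto
  qed simp
  from this[OF finite_class.finite_UNIV]
  obtain u and d :: "'n \<Rightarrow> real" where eig: "\<And>k. A *v u k = d k *\<^sub>R u k"
    and ort: "\<And>k l. cinner (u k) (u l) = (if k = l then 1 else 0)" by auto
  define U :: "complex ^ 'n ^ 'n" where "U = (\<chi> i k. u k $ i)"
  have U: "unitary U"
    using ort by (simp add: unitary_def vec_eq_iff matrix_matrix_mult_def U_def mat_def cinner_def)
  have "A ** U = U ** diag_mat d"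
  proof -
    have "(A ** U) $ i $ k = (A *v u k) $ i" for i k
      by (simp add: matrix_matrix_mult_def matrix_vector_mult_def U_def)
    moreover have "(U ** diag_mat d) $ i $ k = (d k *\<^sub>R u k) $ i" for i k
      by (simp add: matrix_matrix_mult_def diag_mat_def U_def if_distrib sum.delta cong: if_cong)
         (simp add: scaleR_conv_of_real mult.commute)
    ultimately show ?thesis using eig by (simp add: vec_eq_iff)
  qed
  hence "A = U ** diag_mat d ** mat_adjoint U"
    using unitary_cancel(3)[OF U, of A] by simp
  with U that show ?thesis by blast
qed

section \<open>Spectral calculus and the matrix exponential\<close>

lemma diag_mat_mult_left [simp]: "(diag_mat d ** A) $ i $ j = complex_of_real (d i) * A $ i $ j"
  by (simp add: matrix_matrix_mult_def diag_mat_def mult_delta_left)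

lemma diag_mat_mult_right [simp]: "(A ** diag_mat d) $ i $ j = A $ i $ j * complex_of_real (d j)"
  by (simp add: matrix_matrix_mult_def diag_mat_def mult_delta_right)

lemma diag_mat_mult_vec [simp]: "(diag_mat d *v v) $ i = complex_of_real (d i) * v $ i"
  by (simp add: matrix_vector_mult_def diag_mat_def mult_delta_left)

lemma diag_mat_mult: "diag_mat d ** diag_mat e = diag_mat (\<lambda>i. d i * e i)"
  by (simp add: vec_eq_iff) (simp add: diag_mat_def)

lemma mat_adjoint_diag_mat [simp]: "mat_adjoint (diag_mat d) = diag_mat d"
  by (auto simp: vec_eq_iff diag_mat_def)

text \<open>Functional calculus in a fixed eigenbasis \<open>U\<close>: sums, products and
  exponentials become pointwise operations on \<open>d\<close>.\<close>

definition spectral_mat :: "complex ^ 'n ^ 'n \<Rightarrow> ('n \<Rightarrow> real) \<Rightarrow> complex ^ 'n ^ 'n" where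
  "spectral_mat U d = U ** diag_mat d ** mat_adjoint U"

lemma spectral_mat_nth:
  "spectral_mat U d $ i $ j = (\<Sum>k\<in>UNIV. U $ i $ k * complex_of_real (d k) * cnj (U $ j $ k))"
  unfolding spectral_mat_def by (simp add: matrix_matrix_mult_def[of "U ** diag_mat d"])

lemma spectral_mat_exists:
  assumes "self_adjoint A" obtains U d where "unitary U" "A = spectral_mat U d"
  using spectral_decomposition[OF assms] unfolding spectral_mat_def by metis

lemma self_adjoint_spectral_mat [simp]: "self_adjoint (spectral_mat U d)"
  by (simp add: self_adjoint_def spectral_mat_def mat_adjoint_mult matrix_mul_assoc)

lemma spectral_mat_mult:
  assumes "unitary U"
  shows "spectral_mat U d ** spectral_mat U e = spectral_mat U (\<lambda>i. d i * e i)"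
proof -
  have "spectral_mat U d ** spectral_mat U e
      = U ** diag_mat d ** (mat_adjoint U ** U) ** diag_mat e ** mat_adjoint U"
    by (simp add: spectral_mat_def matrix_mul_assoc)
  also have "\<dots> = U ** (diag_mat d ** diag_mat e) ** mat_adjoint U"
    using assms by (simp add: unitary_def matrix_mul_assoc)
  finally show ?thesis by (simp add: diag_mat_mult spectral_mat_def)
qed

lemma spectral_mat_add: "spectral_mat U d + spectral_mat U e = spectral_mat U (\<lambda>k. d k + e k)"
  by (simp add: vec_eq_iff spectral_mat_nth sum.distrib algebra_simps)

lemma spectral_mat_scaleR: "c *\<^sub>R spectral_mat U d = spectral_mat U (\<lambda>k. c * d k)"
  by (simp add: vec_eq_iff spectral_mat_nth scaleR_sum_right) (simp add: scaleR_conv_of_real mult_ac)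

lemma diag_mat_1: "diag_mat (\<lambda>k. 1) = mat 1"
  by (auto simp: vec_eq_iff diag_mat_def mat_def)

lemma spectral_mat_one: "unitary U \<Longrightarrow> spectral_mat U (\<lambda>k. 1) = mat 1"
  by (simp add: spectral_mat_def diag_mat_1 unitary_right)

lemma spectral_mat_const: "unitary U \<Longrightarrow> spectral_mat U (\<lambda>k. c) = c *\<^sub>R mat 1"
  using spectral_mat_scaleR[of c U "\<lambda>k. 1"] by (simp add: spectral_mat_one)

text \<open>Taking the real part lets traces of products be compared as real numbers without a
  separate proof that they are real.\<close>

definition retr :: "complex ^ 'n ^ 'n \<Rightarrow> real" where
  "retr A = Re (trace A)"

lemma retr_add: "retr (A + B) = retr A + retr B"
  by (simp add: retr_def trace_add)

lemma retr_scaleR: "retr (c *\<^sub>R A) = c * retr A"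
  by (simp add: retr_def trace_def sum_distrib_left)

lemma retr_mult_commute: "retr (A ** B) = retr (B ** A)" for A :: "complex ^ 'n ^ 'm"
  unfolding retr_def by (subst trace_mul_sym) (rule refl)

lemma retr_mat_1: "retr (mat 1 :: complex ^ 'n ^ 'n) = CARD('n)"
  by (simp add: retr_def trace_I)

lemma retr_conj_unitary: "unitary U \<Longrightarrow> retr (mat_adjoint U ** A ** U) = retr A"
  by (metis retr_mult_commute unitary_cancel(2) matrix_mul_assoc)

lemma retr_spectral_mat: "unitary U \<Longrightarrow> retr (spectral_mat U d) = (\<Sum>k\<in>UNIV. d k)"
proof -
  assume U: "unitary U"
  have "retr (spectral_mat U d) = retr (diag_mat d)"
    unfolding spectral_mat_def
    by (metis retr_mult_commute unitary_cancel(1) matrix_mul_assoc U)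
  thus ?thesis by (simp add: retr_def trace_def diag_mat_def)
qed

section \<open>Matrix exponential\<close>

primrec mat_pow :: "complex ^ 'n ^ 'n \<Rightarrow> nat \<Rightarrow> complex ^ 'n ^ 'n" where
  "mat_pow A 0 = mat 1"
| "mat_pow A (Suc n) = A ** mat_pow A n"

text \<open>The entrywise power series makes measurable dependence on \<open>A\<close> a matter of
  limits of polynomials in the entries. On self-adjoint matrices the series converges and agrees
  with the functional calculus.\<close>

definition mat_exp :: "complex ^ 'n ^ 'n \<Rightarrow> complex ^ 'n ^ 'n" where
  "mat_exp A = (\<chi> i j. \<Sum>n. mat_pow A n $ i $ j / fact n)"

lemma mat_pow_spectral_mat:
  "unitary U \<Longrightarrow> mat_pow (spectral_mat U d) n = spectral_mat U (\<lambda>k. d k ^ n)"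
  by (induction n) (simp_all add: spectral_mat_one spectral_mat_mult)

lemma mat_exp_spectral_mat:
  assumes "unitary U"
  shows "mat_exp (spectral_mat U d) = spectral_mat U (\<lambda>k. exp (d k))"
proof -
  have "(\<lambda>n. mat_pow (spectral_mat U d) n $ i $ j / fact n) sums spectral_mat U (\<lambda>k. exp (d k)) $ i $ j" for i j
  proof -
    have "(\<lambda>n. \<Sum>k\<in>UNIV. U $ i $ k * complex_of_real (d k ^ n /\<^sub>R fact n) * cnj (U $ j $ k))
        sums (\<Sum>k\<in>UNIV. U $ i $ k * complex_of_real (exp (d k)) * cnj (U $ j $ k))"
      by (intro sums_sum sums_mult sums_mult2 sums_of_real exp_converges)
    moreover have "(\<Sum>k\<in>UNIV. U $ i $ k * complex_of_real (d k ^ n /\<^sub>R fact n) * cnj (U $ j $ k))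
        = mat_pow (spectral_mat U d) n $ i $ j / fact n" for n
      by (simp add: mat_pow_spectral_mat[OF assms] spectral_mat_nth sum_divide_distrib divide_simps)
    ultimately show ?thesis by (simp add: spectral_mat_nth)
  qed
  thus ?thesis by (simp add: mat_exp_def vec_eq_iff sums_unique[symmetric])
qed

lemma self_adjoint_mat_exp: "self_adjoint A \<Longrightarrow> self_adjoint (mat_exp A)"
  by (metis spectral_mat_exists mat_exp_spectral_mat self_adjoint_spectral_mat)

lemma mat_exp_0: "mat_exp (0 :: complex ^ 'n ^ 'n) = mat 1"
proof -
  have U: "unitary (mat 1 :: complex ^ 'n ^ 'n)" by (simp add: unitary_def)
  show ?thesis
    using mat_exp_spectral_mat[OF U, of "\<lambda>k. 0"] by (simp add: spectral_mat_const[OF U])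
qed

section \<open>Quadratic forms, the Loewner order and traces of exponentials\<close>

abbreviation qform :: "complex ^ 'n ^ 'n \<Rightarrow> complex ^ 'n \<Rightarrow> real" where
  "qform A v \<equiv> inner v (A *v v)"

lemma qform_scaleR_mat: "qform (c *\<^sub>R A) v = c * qform A v"
  by (simp add: inner_vec_def matrix_vector_mult_def sum_distrib_left
      flip: scaleR_sum_right)

lemma qform_spectral_mat:
  "qform (spectral_mat U d) v = (\<Sum>k\<in>UNIV. d k * (cmod ((mat_adjoint U *v v) $ k))\<^sup>2)"
proof -
  define w where "w = mat_adjoint U *v v"
  have "qform (spectral_mat U d) v = inner w (diag_mat d *v w)"
    by (simp add: spectral_mat_def inner_mat_adjoint w_def mat_adjoint_mult flip: matrix_vector_mul_assoc)
  also have "diag_mat d *v w = (\<chi> k. d k *\<^sub>R w $ k)"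
    by (simp add: vec_eq_iff) (simp add: scaleR_conv_of_real)
  also have "inner w (\<chi> k. d k *\<^sub>R w $ k) = (\<Sum>k\<in>UNIV. d k * (cmod (w $ k))\<^sup>2)"
    by (simp add: inner_vec_def power2_norm_eq_inner)
  finally show ?thesis by (simp add: w_def)
qed

lemma unitary_sum_cmod:
  assumes "unitary U"
  shows "(\<Sum>k\<in>UNIV. (cmod ((mat_adjoint U *v v) $ k))\<^sup>2) = (norm v)\<^sup>2"
  using qform_spectral_mat[of v U "\<lambda>k. 1"] by (simp add: spectral_mat_one[OF assms] power2_norm_eq_inner)

lemma mat_vec_mult_axis: "A *v axis k 1 = column k A" for A :: "complex ^ 'n ^ 'm"
  by (simp add: vec_eq_iff matrix_vector_mult_def axis_def column_def mult_delta_right)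

lemma unitary_column:
  assumes "unitary U"
  shows "mat_adjoint U *v column k U = axis k 1" "norm (column k U) = 1"
proof -
  have "(mat_adjoint U *v column k U) $ i = (mat_adjoint U ** U) $ i $ k" for i
    by (simp add: matrix_vector_mult_def matrix_matrix_mult_def column_def)
  thus *: "mat_adjoint U *v column k U = axis k 1"
    using assms by (simp add: vec_eq_iff unitary_def mat_def axis_def)
  have "(norm (column k U))\<^sup>2 = (\<Sum>l\<in>UNIV. (cmod (axis k 1 $ l))\<^sup>2)"
    using unitary_sum_cmod[OF assms, of "column k U"] by (simp add: *)
  also have "\<dots> = (\<Sum>l\<in>UNIV. if l = k then 1 else 0)"
    by (intro sum.cong) (auto simp: axis_def)
  finally have "(norm (column k U))\<^sup>2 = 1\<^sup>2" by simp
  thus "norm (column k U) = 1" by (rule power2_eq_imp_eq) auto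
qed

lemma qform_spectral_mat_column:
  assumes "unitary U" shows "qform (spectral_mat U d) (column k U) = d k"
proof -
  have "qform (spectral_mat U d) (column k U) = (\<Sum>l\<in>UNIV. if l = k then d k else 0)"
    unfolding qform_spectral_mat unitary_column[OF assms]
    by (intro sum.cong) (auto simp: axis_def)
  thus ?thesis by simp
qed

lemma retr_eq_sum_qform:
  assumes "unitary U" shows "retr A = (\<Sum>k\<in>UNIV. qform A (column k U))"
proof -
  have "retr A = retr (mat_adjoint U ** (A ** U))"
    using retr_conj_unitary[OF assms, of A] by (simp add: matrix_mul_assoc)
  also have "\<dots> = (\<Sum>k\<in>UNIV. qform A (column k U))"
    by (simp add: retr_def trace_def matrix_matrix_mult_def inner_vec_def inner_complex_def
        matrix_vector_mult_def column_def)
  finally show ?thesis .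
qed

text \<open>Jensen's inequality for the spectral measure of \<open>A\<close> at the unit vector \<open>v\<close>.\<close>

lemma exp_qform_le:
  assumes "self_adjoint A" "norm v = 1"
  shows "exp (qform A v) \<le> qform (mat_exp A) v"
proof -
  obtain U d where U: "unitary U" and A: "A = spectral_mat U d"
    using spectral_mat_exists[OF assms(1)] .
  define w where "w k = (cmod ((mat_adjoint U *v v) $ k))\<^sup>2" for k
  have w: "sum w UNIV = 1" "\<And>k. w k \<ge> 0"
    using unitary_sum_cmod[OF U, of v] assms(2) by (simp_all add: w_def)
  define m where "m = qform A v"
  have m: "m = (\<Sum>k\<in>UNIV. d k * w k)" by (simp add: m_def A qform_spectral_mat w_def)
  \<comment> \<open>The tangent of \<open>exp\<close> at the mean \<open>m\<close>; its linear part
    averages to zero under the weights \<open>w\<close>.\<close>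
  have "exp m = (\<Sum>k\<in>UNIV. exp m * (1 + (d k - m)) * w k)"
    by (simp add: m[symmetric] w algebra_simps sum.distrib sum_subtractf flip: sum_distrib_left)
  also have "\<dots> \<le> (\<Sum>k\<in>UNIV. exp (d k) * w k)"
  proof (intro sum_mono mult_right_mono)
    fix k
    have "exp m * (1 + (d k - m)) \<le> exp m * exp (d k - m)" by (intro mult_left_mono) auto
    thus "exp m * (1 + (d k - m)) \<le> exp (d k)" by (simp flip: exp_add)
  qed (use w in auto)
  also have "\<dots> = qform (mat_exp A) v"
    by (simp add: A mat_exp_spectral_mat[OF U] qform_spectral_mat w_def)
  finally show ?thesis by (simp add: m_def)
qed

text \<open>The Loewner order is expressed by comparing quadratic forms at every vector. The
  exponential is not operator monotone, but its trace is monotone: in an eigenbasis of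
  \<open>A\<close> the left side is a sum of exponentials of the form of \<open>A\<close>, and
  Jensen's inequality is applied to \<open>B\<close> at the same basis vectors.\<close>

lemma retr_mat_exp_mono:
  assumes "self_adjoint A" "self_adjoint B" "\<And>v. qform A v \<le> qform B v"
  shows "retr (mat_exp A) \<le> retr (mat_exp B)"
proof -
  obtain U d where U: "unitary U" and A: "A = spectral_mat U d"
    using spectral_mat_exists[OF assms(1)] .
  have "retr (mat_exp A) = (\<Sum>k\<in>UNIV. exp (qform A (column k U)))"
    by (simp add: A mat_exp_spectral_mat[OF U] retr_spectral_mat[OF U] qform_spectral_mat_column[OF U])
  also have "\<dots> \<le> (\<Sum>k\<in>UNIV. exp (qform B (column k U)))"
    by (intro sum_mono) (use assms in auto)
  also have "\<dots> \<le> (\<Sum>k\<in>UNIV. qform (mat_exp B) (column k U))"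
    by (intro sum_mono exp_qform_le assms unitary_column[OF U])
  finally show ?thesis by (simp add: retr_eq_sum_qform[OF U])
qed

lemma qform_le_retr:
  assumes "self_adjoint A" "\<And>v. qform A v \<ge> 0" "norm v = 1"
  shows "qform A v \<le> retr A"
proof -
  obtain U d where U: "unitary U" and A: "A = spectral_mat U d"
    using spectral_mat_exists[OF assms(1)] .
  have d: "d k \<ge> 0" for k
    using assms(2)[of "column k U"] by (simp add: A qform_spectral_mat_column[OF U])
  have "(cmod ((mat_adjoint U *v v) $ k))\<^sup>2 \<le> 1" for k
    using unitary_sum_cmod[OF U, of v] assms(3)
      member_le_sum[of k UNIV "\<lambda>k. (cmod ((mat_adjoint U *v v) $ k))\<^sup>2"] by simp
  hence "(\<Sum>k\<in>UNIV. d k * (cmod ((mat_adjoint U *v v) $ k))\<^sup>2) \<le> (\<Sum>k\<in>UNIV. d k)"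
    by (intro sum_mono mult_left_le d)
  thus ?thesis by (simp add: A qform_spectral_mat retr_spectral_mat[OF U])
qed

lemma qform_mat_exp_nonneg: "self_adjoint A \<Longrightarrow> qform (mat_exp A) v \<ge> 0"
  by (elim spectral_mat_exists) (simp add: mat_exp_spectral_mat qform_spectral_mat sum_nonneg)

text \<open>A lower bound on the form at a single unit vector already makes the trace large, since
  all eigenvalues of the exponential are positive.\<close>

lemma exp_le_retr_mat_exp:
  assumes "self_adjoint A" "norm v = 1" "c \<le> qform A v"
  shows "exp c \<le> retr (mat_exp A)"
proof -
  have "exp c \<le> exp (qform A v)" using assms by simp
  also have "\<dots> \<le> qform (mat_exp A) v" by (rule exp_qform_le) fact+
  also have "\<dots> \<le> retr (mat_exp A)"
    by (intro qform_le_retr self_adjoint_mat_exp qform_mat_exp_nonneg assms)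
  finally show ?thesis .
qed

lemma retr_mat_exp_nonneg: "self_adjoint A \<Longrightarrow> retr (mat_exp A) \<ge> 0"
  by (elim spectral_mat_exists) (simp add: mat_exp_spectral_mat retr_spectral_mat sum_nonneg)

lemma retr_mat_exp_add_scalar:
  assumes "self_adjoint A"
  shows "retr (mat_exp (A + c *\<^sub>R mat 1)) = exp c * retr (mat_exp A)"
proof -
  obtain U d where U: "unitary U" and A: "A = spectral_mat U d"
    using spectral_mat_exists[OF assms] .
  have "A + c *\<^sub>R mat 1 = spectral_mat U (\<lambda>k. d k + c)"
    by (simp add: A spectral_mat_add flip: spectral_mat_const[OF U])
  thus ?thesis
    by (simp add: A mat_exp_spectral_mat[OF U] retr_spectral_mat[OF U] exp_add sum_distrib_left mult.commute)
qed

section \<open>Eigenvalues, singular values and the spectral norm\<close>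

lemma is_eigenvalue_spectral_mat:
  assumes U: "unitary U"
  shows "is_eigenvalue (spectral_mat U d) (complex_of_real r) \<longleftrightarrow> r \<in> range d"
proof
  assume "is_eigenvalue (spectral_mat U d) (complex_of_real r)"
  then obtain v where v: "v \<noteq> 0" "spectral_mat U d *v v = complex_of_real r *s v"
    by (auto simp: is_eigenvalue_def)
  define w where "w = mat_adjoint U *v v"
  have Uw: "U *v w = v"
    using unitary_right[OF U] by (simp add: w_def matrix_vector_mul_assoc)
  then obtain k where k: "w $ k \<noteq> 0"
    using v(1) by (metis matrix_vector_mult_0_right vec_eq_iff zero_index)
  have "mat_adjoint U *v (spectral_mat U d *v v) = diag_mat d *v w"
    using U by (simp add: spectral_mat_def w_def matrix_vector_mul_assoc matrix_mul_assoc unitary_def)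
  hence "diag_mat d *v w = complex_of_real r *s w"
    by (simp add: v(2) w_def vector_scalar_commute)
  hence "(diag_mat d *v w) $ k = complex_of_real r * w $ k" by simp
  moreover have "(diag_mat d *v w) $ k = complex_of_real (d k) * w $ k"
    by simp
  ultimately have "complex_of_real (d k) = complex_of_real r" using k by simp
  thus "r \<in> range d" by (metis of_real_eq_iff rangeI)
next
  assume "r \<in> range d"
  then obtain k where k: "r = d k" by auto
  have "spectral_mat U d *v column k U = U *v (diag_mat d *v axis k 1)"
    by (simp add: spectral_mat_def unitary_column[OF U] flip: matrix_vector_mul_assoc)
  also have "diag_mat d *v axis k 1 = complex_of_real r *s axis k 1"
    by (simp add: vec_eq_iff axis_def k)
  also have "U *v (complex_of_real r *s axis k 1) = complex_of_real r *s column k U"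
    by (simp add: vector_scalar_commute mat_vec_mult_axis)
  finally show "is_eigenvalue (spectral_mat U d) (complex_of_real r)"
    using unitary_column(2)[OF U, of k] unfolding is_eigenvalue_def
    by (intro exI[of _ "column k U"]) auto
qed

lemma lambda_max_spectral_mat: "unitary U \<Longrightarrow> lambda_max (spectral_mat U d) = Max (range d)"
  by (simp add: lambda_max_def is_eigenvalue_spectral_mat)

lemma qform_le_lambda_max:
  assumes "self_adjoint A" shows "qform A v \<le> lambda_max A * (norm v)\<^sup>2"
proof -
  obtain U d where U: "unitary U" and A: "A = spectral_mat U d"
    using spectral_mat_exists[OF assms] .
  have "qform A v \<le> (\<Sum>k\<in>UNIV. lambda_max A * (cmod ((mat_adjoint U *v v) $ k))\<^sup>2)"
    unfolding A qform_spectral_mat lambda_max_spectral_mat[OF U]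
    by (intro sum_mono mult_right_mono) auto
  thus ?thesis by (simp add: unitary_sum_cmod[OF U] flip: sum_distrib_left)
qed

lemma lambda_max_attained:
  assumes "self_adjoint A" obtains v where "norm v = 1" "qform A v = lambda_max A"
proof -
  obtain U d where U: "unitary U" and A: "A = spectral_mat U d"
    using spectral_mat_exists[OF assms] .
  have "Max (range d) \<in> range d" by (intro Max_in) auto
  then obtain k where "Max (range d) = d k" unfolding image_iff by blast
  thus ?thesis
    using that[of "column k U"] unitary_column[OF U]
    by (simp add: A lambda_max_spectral_mat[OF U] qform_spectral_mat_column[OF U])
qed

text \<open>Diagonalising \<open>mat_adjoint A ** A\<close> exhibits the singular values as the
  square roots of the values of \<open>d\<close>. This set is finite and nonempty, so
  \<open>spectral_norm\<close> is a genuine maximum.\<close>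

lemma norm_mult_le_spectral_norm:
  fixes A :: "complex ^ 'n ^ 'm"
  shows "norm (A *v v) \<le> spectral_norm A * norm v"
proof -
  obtain U d where U: "unitary U" and A: "mat_adjoint A ** A = spectral_mat U d"
    using spectral_mat_exists[OF self_adjoint_adjoint_mult] .
  have q: "qform (mat_adjoint A ** A) v = (norm (A *v v))\<^sup>2" for v
    by (simp add: inner_mat_adjoint mat_adjoint_mult power2_norm_eq_inner flip: matrix_vector_mul_assoc)
  have d: "d k \<ge> 0" for k
    using q[of "column k U"] by (simp add: A qform_spectral_mat_column[OF U])
  have sv: "singular_values A = sqrt ` range d"
    by (auto simp: singular_values_def A is_eigenvalue_spectral_mat[OF U] d image_iff
        simp del: of_real_power) (metis real_sqrt_unique)
  have s: "sqrt (d k) \<le> spectral_norm A" for k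
    unfolding spectral_norm_def sv by (intro Max_ge) auto
  have "d k \<le> (spectral_norm A)\<^sup>2" for k
    using power_mono[OF s[of k], of 2] d[of k] by simp
  hence "(norm (A *v v))\<^sup>2 \<le> (\<Sum>k\<in>UNIV. (spectral_norm A)\<^sup>2 * (cmod ((mat_adjoint U *v v) $ k))\<^sup>2)"
    unfolding q[symmetric] A qform_spectral_mat by (intro sum_mono mult_right_mono) auto
  hence "(norm (A *v v))\<^sup>2 \<le> (spectral_norm A * norm v)\<^sup>2"
    by (simp add: unitary_sum_cmod[OF U] power_mult_distrib flip: sum_distrib_left)
  \<comment> \<open>Here \<open>undefined\<close> is an arbitrary index: any singular value shows
    that the maximum is nonnegative.\<close>
  moreover have "0 \<le> spectral_norm A" using s[of undefined] d by (meson order_trans real_sqrt_ge_zero)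
  ultimately show ?thesis by (simp add: power2_le_iff_abs_le)
qed

text \<open>An entry is a coordinate of the image of a unit vector. Through this bound the entries
  inherit integrability from the spectral norm.\<close>

lemma cmod_le_spectral_norm: "cmod (A $ i $ j) \<le> spectral_norm A"
proof -
  have "cmod (A $ i $ j) = cmod ((A *v axis j 1) $ i)"
    by (simp add: mat_vec_mult_axis column_def)
  also have "\<dots> \<le> norm (A *v axis j 1)" by (rule Finite_Cartesian_Product.norm_nth_le)
  also have "\<dots> \<le> spectral_norm A" using norm_mult_le_spectral_norm[of A "axis j 1"] by simp
  finally show ?thesis .
qed

lemma qform_le_spectral_norm:
  assumes "norm v = 1" shows "qform A v \<le> spectral_norm A"
  using norm_cauchy_schwarz[of v "A *v v"] norm_mult_le_spectral_norm[of A v] assms by simp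

section \<open>Explicit antiderivatives\<close>

text \<open>Stands in for positivity of an improper integral: \<open>f\<close> is the
  antiderivative, vanishing at 0, of a nonnegative integrand, and \<open>L\<close> is the integral
  over the half-line.\<close>

lemma nondecreasing_limit_nonneg:
  fixes f :: "real \<Rightarrow> real"
  assumes "f 0 = 0" "(f \<longlongrightarrow> L) at_top"
    and "\<And>s. s \<ge> 0 \<Longrightarrow> (f has_real_derivative f' s) (at s)" "\<And>s. s \<ge> 0 \<Longrightarrow> f' s \<ge> 0"
  shows "L \<ge> 0"
proof (rule tendsto_lowerbound[OF assms(2)])
  show "\<forall>\<^sub>F s in at_top. 0 \<le> f s"
    using eventually_ge_at_top[of 0]
  proof eventually_elim
    case (elim s)
    have "f 0 \<le> f s"
      by (rule DERIV_nonneg_imp_nondecreasing[OF elim]) (use assms in blast)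
    thus ?case by (simp add: assms)
  qed
qed simp

lemma tendsto_ln_diff_at_top:
  fixes a b c d :: real
  assumes "b > 0" "d > 0"
  shows "((\<lambda>s. ln (a + s * b) - ln (c + s * d)) \<longlongrightarrow> ln b - ln d) at_top"
proof -
  have "((\<lambda>s. (a / s + b) / (c / s + d)) \<longlongrightarrow> (0 + b) / (0 + d)) at_top"
    by (intro tendsto_intros tendsto_divide_0[OF tendsto_const] filterlim_at_top_imp_at_infinity filterlim_ident)
       (use assms in auto)
  hence "((\<lambda>s. ln ((a / s + b) / (c / s + d))) \<longlongrightarrow> ln (b / d)) at_top"
    by (intro tendsto_ln) (use assms in auto)
  moreover have "\<forall>\<^sub>F s in at_top. ln ((a / s + b) / (c / s + d)) = ln (a + s * b) - ln (c + s * d)"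
    using eventually_gt_at_top[of 0] eventually_gt_at_top[of "\<bar>a\<bar> / b"] eventually_gt_at_top[of "\<bar>c\<bar> / d"]
  proof eventually_elim
    case (elim s)
    hence "a + s * b > 0" "c + s * d > 0" using assms by (auto simp: field_simps abs_if split: if_splits)
    moreover have "(a / s + b) / (c / s + d) = (a + s * b) / (c + s * d)"
    proof -
      have "a / s + b = (a + s * b) / s" "c / s + d = (c + s * d) / s"
        using elim by (simp_all add: add_divide_distrib)
      thus ?thesis using elim by simp
    qed
    ultimately show ?case by (simp add: ln_div)
  qed
  ultimately show ?thesis
    using assms by (simp add: ln_div tendsto_cong)
qed

lemma affine_pos: "a > 0 \<Longrightarrow> b > 0 \<Longrightarrow> s \<ge> 0 \<Longrightarrow> a + s * b > 0" for a b s :: real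
  by (simp add: add_pos_nonneg)

text \<open>The divided difference of \<open>x * ln x\<close> at \<open>a\<close> and
  \<open>b\<close>, with the derivative on the diagonal.\<close>

definition log_kernel_const :: "real \<Rightarrow> real \<Rightarrow> real" where
  "log_kernel_const a b = (if a = b then ln a + 1 else (a * ln a - b * ln b) / (a - b))"

text \<open>The integrand is the coefficient of the entropy's tangent in the direction of
  \<open>T\<close>, for eigenvalues \<open>a\<close>, \<open>b\<close> of the base point of
  \<open>T\<close> and \<open>c\<close> of that of \<open>A\<close>. Its first three terms add up to
  a tail of order 1/s, which \<open>1 / (1 + s)\<close> cancels. On the diagonal the antiderivative
  acquires a rational term.\<close>

lemma log_kernel_antiderivative:
  fixes a b c :: real
  assumes [simp]: "a > 0" "b > 0" "c > 0"
  shows "\<exists>f. f 0 = 0 \<and> (f \<longlongrightarrow> log_kernel_const a b - ln c) at_top \<and>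
    (\<forall>s\<ge>0. (f has_real_derivative
      a / (c + s * a) + b / (c + s * b) - s * (a / (c + s * a)) * (b / (c + s * b)) - 1 / (1 + s)) (at s))"
proof (cases "a = b")
  case True
  define f where "f s = ln (c + s * a) - ln (1 + s * 1) + (1 - c / (c + s * a)) - ln c" for s
  have "f 0 = 0" using less_imp_neq[OF assms(3)] by (simp add: f_def)
  moreover have "((\<lambda>s. c / (c + s * a)) \<longlongrightarrow> 0) at_top"
    by (intro tendsto_divide_0[OF tendsto_const] filterlim_at_top_imp_at_infinity
        filterlim_tendsto_add_at_top[OF tendsto_const] filterlim_at_top_mult_tendsto_pos[OF tendsto_const] filterlim_ident) simp
  hence "(f \<longlongrightarrow> (ln a - ln 1) + (1 - 0) - ln c) at_top"
    unfolding f_def by (intro tendsto_intros tendsto_ln_diff_at_top) auto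
  moreover have "(f has_real_derivative
      a / (c + s * a) + b / (c + s * b) - s * (a / (c + s * a)) * (b / (c + s * b)) - 1 / (1 + s)) (at s)"
    if "s \<ge> 0" for s
  proof -
    have pos: "c + s * a > 0" "1 + s > 0" using that assms by (simp_all add: affine_pos)
    define u where "u = a / (c + s * a)"
    have "(f has_real_derivative a / (c + s * a) - 1 / (1 + s) + c * a / ((c + s * a) * (c + s * a))) (at s)"
      unfolding f_def using pos by (auto intro!: derivative_eq_intros)
    moreover have "c * a / ((c + s * a) * (c + s * a)) = u - s * u * u"
    proof -
      have "c = (c + s * a) * (1 - s * u)" using pos by (simp add: u_def right_diff_distrib)
      hence "c / (c + s * a) = 1 - s * u" using pos by (metis less_irrefl nonzero_mult_div_cancel_left)
      hence "(c / (c + s * a)) * u = (1 - s * u) * u" by simp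
      thus ?thesis by (simp add: u_def algebra_simps)
    qed
    moreover have "u - 1 / (1 + s) + (u - s * u * u) = u + u - s * u * u - 1 / (1 + s)" by simp
    ultimately show ?thesis using True by (simp only: u_def)
  qed
  ultimately show ?thesis using True
    by (intro exI[of _ f]) (simp add: log_kernel_const_def)
next
  case False
  define f where "f s = (a * (ln (c + s * a) - ln (1 + s * 1)) - b * (ln (c + s * b) - ln (1 + s * 1))) / (a - b) - ln c" for s
  have "f 0 = 0" using False by (simp add: f_def field_simps)
  moreover have "(f \<longlongrightarrow> (a * (ln a - ln 1) - b * (ln b - ln 1)) / (a - b) - ln c) at_top"
    unfolding f_def by (intro tendsto_intros tendsto_ln_diff_at_top) (use False in auto)
  moreover have "(f has_real_derivative
      a / (c + s * a) + b / (c + s * b) - s * (a / (c + s * a)) * (b / (c + s * b)) - 1 / (1 + s)) (at s)"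
    if "s \<ge> 0" for s
  proof -
    have pos: "c + s * a > 0" "c + s * b > 0" "1 + s > 0" using that assms by (simp_all add: affine_pos)
    have "(f has_real_derivative (a * (a / (c + s * a) - 1 / (1 + s)) - b * (b / (c + s * b) - 1 / (1 + s))) / (a - b)) (at s)"
      unfolding f_def using pos
      by (auto intro!: derivative_eq_intros simp: False)
    moreover have "(a * (a / (c + s * a) - 1 / (1 + s)) - b * (b / (c + s * b) - 1 / (1 + s)))
        = (a - b) * (a / (c + s * a) + b / (c + s * b) - s * (a / (c + s * a)) * (b / (c + s * b)) - 1 / (1 + s))"
    proof -
      define u v w where "u = a / (c + s * a)" and "v = b / (c + s * b)" and "w = 1 / (1 + s)"
      \<comment> \<open>These two relations turn the claim, multiplied by \<open>c\<close>, into a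
        polynomial identity.\<close>
      have "u * c = a - s * a * u" "v * c = b - s * b * v"
        using pos by (simp_all add: u_def v_def field_simps)
      hence "c * (a * u - b * v) = c * ((a - b) * (u + v - s * u * v))" by algebra
      hence "a * u - b * v = (a - b) * (u + v - s * u * v)" using assms by simp
      hence "a * (u - w) - b * (v - w) = (a - b) * (u + v - s * u * v - w)" by (simp add: algebra_simps)
      thus ?thesis by (simp add: u_def v_def w_def)
    qed
    ultimately show ?thesis using False by simp
  qed
  ultimately show ?thesis using False
    by (intro exI[of _ f]) (simp add: log_kernel_const_def)
qed

text \<open>These integrals are the coefficients of the tangent in the direction of
  \<open>A\<close>. The limit is made explicit for \<open>b = c\<close>: in its own eigenbasis
  \<open>mat_exp G\<close> is diagonal, so the value at the point of tangency involves diagonal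
  coefficients alone.\<close>

lemma resolvent_kernel_antiderivative:
  fixes b c a :: real
  assumes [simp]: "a > 0" "b > 0" "c > 0"
  shows "\<exists>f L. f 0 = 0 \<and> (f \<longlongrightarrow> L) at_top \<and> (b = c \<longrightarrow> L = a / b) \<and>
    (\<forall>s\<ge>0. (f has_real_derivative a / (b + s * a) * (a / (c + s * a))) (at s))"
proof (cases "b = c")
  case True
  define f where "f s = a / b - a / (b + s * a)" for s
  have "f 0 = 0" using assms by (simp add: f_def)
  moreover have "((\<lambda>s. a / (b + s * a)) \<longlongrightarrow> 0) at_top"
    by (intro tendsto_divide_0[OF tendsto_const] filterlim_at_top_imp_at_infinity
        filterlim_tendsto_add_at_top[OF tendsto_const] filterlim_at_top_mult_tendsto_pos[OF tendsto_const] filterlim_ident) simp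
  hence "(f \<longlongrightarrow> a / b - 0) at_top" unfolding f_def by (intro tendsto_intros)
  moreover have "(f has_real_derivative a / (b + s * a) * (a / (c + s * a))) (at s)" if "s \<ge> 0" for s
  proof -
    have "b + s * a > 0" using that assms by (simp add: affine_pos)
    thus ?thesis unfolding f_def using True
      by (auto intro!: derivative_eq_intros simp: field_simps power2_eq_square)
  qed
  ultimately show ?thesis by auto
next
  case False
  define f where "f s = a / (c - b) * (ln (b + s * a) - ln (c + s * a) - (ln b - ln c))" for s
  have "f 0 = 0" using assms by (simp add: f_def)
  moreover have "(f \<longlongrightarrow> a / (c - b) * ((ln a - ln a) - (ln b - ln c))) at_top"
    unfolding f_def by (intro tendsto_intros tendsto_ln_diff_at_top) auto
  moreover have "(f has_real_derivative a / (b + s * a) * (a / (c + s * a))) (at s)" if "s \<ge> 0" for s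
  proof -
    have pos: "b + s * a > 0" "c + s * a > 0" using that assms by (simp_all add: affine_pos)
    have "(f has_real_derivative a / (c - b) * (a / (b + s * a) - a / (c + s * a))) (at s)"
      unfolding f_def using pos False by (auto intro!: derivative_eq_intros)
    moreover have "a / (b + s * a) - a / (c + s * a) = (a * (c + s * a) - a * (b + s * a)) / ((b + s * a) * (c + s * a))"
      by (rule diff_frac_eq) (use pos in auto)
    moreover have "a * (c + s * a) - a * (b + s * a) = (c - b) * a" by (simp add: algebra_simps)
    ultimately show ?thesis using False by simp
  qed
  ultimately show ?thesis using False by blast
qed

text \<open>The scalar case of the integral representation of the relative entropy.\<close>

lemma square_kernel_antiderivative:
  fixes a t :: real
  assumes [simp]: "a > 0" "t > 0"
  shows "\<exists>f. f 0 = 0 \<and> (f \<longlongrightarrow> t * (ln t - ln a)) at_top \<and>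
    (\<forall>s\<ge>0. (f has_real_derivative t\<^sup>2 / (a + s * t) - t / (1 + s)) (at s))"
proof -
  define f where "f s = t * (ln (a + s * t) - ln (1 + s * 1) - ln a)" for s
  have "f 0 = 0" using assms by (simp add: f_def)
  moreover have "(f \<longlongrightarrow> t * ((ln t - ln 1) - ln a)) at_top"
    unfolding f_def by (intro tendsto_intros tendsto_ln_diff_at_top) auto
  moreover have "(f has_real_derivative t\<^sup>2 / (a + s * t) - t / (1 + s)) (at s)" if "s \<ge> 0" for s
  proof -
    have pos: "a + s * t > 0" "1 + s > 0" using that assms by (simp_all add: affine_pos)
    have "(f has_real_derivative t * (t / (a + s * t) - 1 / (1 + s))) (at s)"
      unfolding f_def using pos by (auto intro!: derivative_eq_intros)
    thus ?thesis by (simp add: power2_eq_square right_diff_distrib)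
  qed
  ultimately show ?thesis by (intro exI[of _ f]) auto
qed

section \<open>Traces of products in two eigenbases\<close>

lemma retr_adjoint_mult:
  "retr (mat_adjoint X ** Y) = (\<Sum>i\<in>UNIV. \<Sum>j\<in>UNIV. Re (cnj (X $ i $ j) * Y $ i $ j))"
  unfolding retr_def trace_def matrix_matrix_mult_def
  by (simp only: vec_lambda_beta mat_adjoint_nth Re_sum) (rule sum.swap)

text \<open>The squared overlaps of the two eigenbases act as weights; they allow scalar integrals
  to be used for matrices that do not commute.\<close>

lemma retr_spectral_mult:
  "retr (spectral_mat P d ** spectral_mat Q e)
    = (\<Sum>i\<in>UNIV. \<Sum>j\<in>UNIV. (cmod ((mat_adjoint P ** Q) $ i $ j))\<^sup>2 * (d i * e j))"
proof -
  define w where "w = mat_adjoint P ** Q"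
  have "retr (spectral_mat P d ** spectral_mat Q e) = retr (P ** (diag_mat d ** w ** diag_mat e ** mat_adjoint Q))"
    by (simp add: spectral_mat_def w_def matrix_mul_assoc)
  also have "\<dots> = retr (diag_mat d ** w ** diag_mat e ** (mat_adjoint Q ** P))"
    by (subst retr_mult_commute) (simp add: matrix_mul_assoc)
  also have "\<dots> = retr (mat_adjoint w ** (diag_mat d ** w ** diag_mat e))"
    by (subst retr_mult_commute) (simp add: w_def mat_adjoint_mult)
  also have "\<dots> = (\<Sum>i\<in>UNIV. \<Sum>j\<in>UNIV. (cmod (w $ i $ j))\<^sup>2 * (d i * e j))"
    unfolding retr_adjoint_mult
  proof (intro sum.cong refl)
    fix i j
    have "cnj (w $ i $ j) * (diag_mat d ** w ** diag_mat e) $ i $ j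
        = (w $ i $ j * cnj (w $ i $ j)) * complex_of_real (d i * e j)"
      by simp
    also have "w $ i $ j * cnj (w $ i $ j) = complex_of_real ((cmod (w $ i $ j))\<^sup>2)"
      by (simp flip: complex_norm_square)
    finally show "Re (cnj (w $ i $ j) * (diag_mat d ** w ** diag_mat e) $ i $ j)
        = (cmod (w $ i $ j))\<^sup>2 * (d i * e j)"
      by (simp flip: of_real_mult of_real_power)
  qed
  finally show ?thesis by (simp add: w_def)
qed

lemma retr_mult_spectral_mat:
  "retr (A ** spectral_mat S d) = (\<Sum>j\<in>UNIV. d j * Re ((mat_adjoint S ** A ** S) $ j $ j))"
proof -
  have "retr (A ** spectral_mat S d) = retr ((A ** S ** diag_mat d) ** mat_adjoint S)"
    by (simp add: spectral_mat_def matrix_mul_assoc)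
  also have "\<dots> = retr (mat_adjoint S ** A ** S ** diag_mat d)"
    by (subst retr_mult_commute) (simp add: matrix_mul_assoc)
  finally show ?thesis
    by (simp add: retr_def trace_def mult.commute)
qed

text \<open>Completing the square entrywise in the eigenbases of the two matrices.\<close>

lemma quadratic_lower_bound:
  assumes P: "unitary P" and Q: "unitary Q" and pos: "\<And>k. \<alpha> k > 0" "\<And>k. \<tau> k > 0" "s \<ge> 0"
  shows "2 * retr (mat_adjoint Z ** spectral_mat Q \<tau>) - retr (spectral_mat P \<alpha> ** Z ** mat_adjoint Z)
      - s * retr (spectral_mat Q \<tau> ** mat_adjoint Z ** Z)
    \<le> (\<Sum>i\<in>UNIV. \<Sum>j\<in>UNIV. (cmod ((mat_adjoint P ** Q) $ i $ j))\<^sup>2 * ((\<tau> j)\<^sup>2 / (\<alpha> i + s * \<tau> j)))"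
proof -
  define w where "w = mat_adjoint P ** Q"
  define z where "z = mat_adjoint P ** Z ** Q"
  have z_adj: "mat_adjoint z = mat_adjoint Q ** mat_adjoint Z ** P"
    by (simp add: z_def mat_adjoint_mult matrix_mul_assoc)
  have 1: "retr (mat_adjoint Z ** spectral_mat Q \<tau>) = retr (mat_adjoint z ** (w ** diag_mat \<tau>))"
  proof -
    have "retr (mat_adjoint z ** (w ** diag_mat \<tau>))
        = retr (mat_adjoint Q ** (mat_adjoint Z ** (P ** (mat_adjoint P ** (Q ** diag_mat \<tau>)))))"
      by (simp add: z_adj w_def matrix_mul_assoc)
    also have "\<dots> = retr (mat_adjoint Z ** Q ** diag_mat \<tau> ** mat_adjoint Q)"
      by (subst retr_mult_commute) (simp add: unitary_cancel[OF P] matrix_mul_assoc)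
    finally show ?thesis by (simp add: spectral_mat_def matrix_mul_assoc)
  qed
  have 2: "retr (spectral_mat P \<alpha> ** Z ** mat_adjoint Z) = retr (mat_adjoint z ** (diag_mat \<alpha> ** z))"
  proof -
    have "retr (mat_adjoint z ** (diag_mat \<alpha> ** z))
        = retr (mat_adjoint Q ** (mat_adjoint Z ** P ** diag_mat \<alpha> ** mat_adjoint P ** Z ** Q))"
      unfolding z_adj by (simp add: z_def matrix_mul_assoc)
    also have "\<dots> = retr (mat_adjoint Z ** (P ** diag_mat \<alpha> ** mat_adjoint P ** Z))"
      by (subst retr_mult_commute) (simp add: unitary_cancel[OF Q] matrix_mul_assoc)
    also have "\<dots> = retr (spectral_mat P \<alpha> ** Z ** mat_adjoint Z)"
      by (subst retr_mult_commute) (simp add: spectral_mat_def matrix_mul_assoc)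
    finally show ?thesis ..
  qed
  have 3: "retr (spectral_mat Q \<tau> ** mat_adjoint Z ** Z) = retr (mat_adjoint z ** (z ** diag_mat \<tau>))"
  proof -
    have "retr (mat_adjoint z ** (z ** diag_mat \<tau>))
        = retr (mat_adjoint Q ** (mat_adjoint Z ** (P ** (mat_adjoint P ** (Z ** (Q ** diag_mat \<tau>))))))"
      unfolding z_adj by (simp add: z_def matrix_mul_assoc)
    also have "\<dots> = retr ((mat_adjoint Z ** Z) ** (Q ** diag_mat \<tau> ** mat_adjoint Q))"
      by (subst retr_mult_commute) (simp add: unitary_cancel[OF P] matrix_mul_assoc)
    also have "\<dots> = retr (spectral_mat Q \<tau> ** mat_adjoint Z ** Z)"
      by (subst retr_mult_commute) (simp add: spectral_mat_def matrix_mul_assoc)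
    finally show ?thesis ..
  qed
  \<comment> \<open>With \<open>c = a + s * t\<close>, the concave function
    \<open>2 * Re (cnj x * (y * t)) - c * (cmod x)\<^sup>2\<close> of \<open>x\<close> is largest at
    \<open>x = t * y / c\<close>, where it equals the right side.\<close>
  have sq: "2 * Re (cnj x * (y * complex_of_real t)) - Re (cnj x * (complex_of_real a * x))
      - s * Re (cnj x * (x * complex_of_real t)) \<le> (cmod y)\<^sup>2 * (t\<^sup>2 / (a + s * t))"
    if "a > 0" "t > 0" for x y :: complex and a t :: real
  proof -
    define c where "c = a + s * t"
    have c: "c > 0" using that pos by (simp add: c_def add_pos_nonneg)
    have "0 \<le> (cmod (complex_of_real t * y - complex_of_real c * x))\<^sup>2 / c" using c by simp
    also have "(cmod (complex_of_real t * y - complex_of_real c * x))\<^sup>2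
        = t\<^sup>2 * (cmod y)\<^sup>2 - c * (2 * Re (cnj x * (y * complex_of_real t))) + c * (c * (cmod x)\<^sup>2)"
      unfolding cmod_power2 by (simp add: algebra_simps power2_eq_square)
    also have "\<dots> / c = t\<^sup>2 * (cmod y)\<^sup>2 / c - 2 * Re (cnj x * (y * complex_of_real t)) + c * (cmod x)\<^sup>2"
      using c by (simp add: add_divide_distrib diff_divide_distrib)
    finally have "2 * Re (cnj x * (y * complex_of_real t)) - c * (cmod x)\<^sup>2 \<le> (cmod y)\<^sup>2 * (t\<^sup>2 / c)"
      by (simp add: mult.commute)
    moreover have "c * (cmod x)\<^sup>2 = Re (cnj x * (complex_of_real a * x)) + s * Re (cnj x * (x * complex_of_real t))"
      unfolding c_def cmod_power2 by (simp add: algebra_simps power2_eq_square)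
    ultimately show ?thesis by (simp only: c_def[symmetric])
  qed
  show ?thesis
    unfolding 1 2 3
    unfolding retr_adjoint_mult sum_distrib_left sum_subtractf[symmetric] w_def[symmetric]
      diag_mat_mult_left diag_mat_mult_right
    by (intro sum_mono sq pos)
qed

section \<open>Lieb's theorem\<close>

text \<open>For \<open>T = mat_exp (H + X)\<close> and \<open>A = mat_exp X\<close> the relative
  entropy equals \<open>retr (T ** H)\<close>. Its tangent taken at \<open>X = G\<close> has the
  value \<open>retr (T ** H) + retr T - retr (M ** A)\<close> there, so the entropy lying above its
  tangent is exactly the inequality claimed.\<close>

theorem Lieb_tangent_functional:
  fixes H G :: "complex ^ 'n ^ 'n"
  assumes H: "self_adjoint H" and G: "self_adjoint G"
  obtains M where "retr (M ** mat_exp G) = retr (mat_exp (H + G))"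
    and "\<And>X. self_adjoint X \<Longrightarrow> retr (mat_exp (H + X)) \<le> retr (M ** mat_exp X)"
proof -
  obtain B \<gamma> where B: "unitary B" and Geq: "G = spectral_mat B \<gamma>"
    using spectral_mat_exists[OF G] .
  obtain S \<kappa> where S: "unitary S" and HGeq: "H + G = spectral_mat S \<kappa>"
    using spectral_mat_exists[OF self_adjoint_add[OF H G]] .
  define \<beta> where "\<beta> i = exp (\<gamma> i)" for i
  define \<sigma> where "\<sigma> j = exp (\<kappa> j)" for j
  have pos: "\<beta> i > 0" "\<sigma> i > 0" for i by (simp_all add: \<beta>_def \<sigma>_def)
  \<comment> \<open>Overlaps between the eigenbases of \<open>G\<close> and \<open>H + G\<close>;
    \<open>\<beta>\<close> and \<open>\<sigma>\<close> are the eigenvalues of the two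
    exponentials.\<close>
  define p where "p = mat_adjoint B ** S"
  have p_unitary: "unitary p"
    unfolding unitary_def p_def mat_adjoint_mult
    using unitary_cancel(2)[OF B, of S] S by (simp add: unitary_def flip: matrix_mul_assoc)
  have "\<forall>i k j. \<exists>f L. f 0 = (0::real) \<and> (f \<longlongrightarrow> L) at_top \<and> (\<beta> i = \<beta> k \<longrightarrow> L = \<sigma> j / \<beta> i) \<and>
    (\<forall>s\<ge>0. (f has_real_derivative \<sigma> j / (\<beta> i + s * \<sigma> j) * (\<sigma> j / (\<beta> k + s * \<sigma> j))) (at s))"
    by (intro allI resolvent_kernel_antiderivative pos)
  then obtain Fm m where Fm: "\<And>i k j. Fm i k j 0 = (0::real)" "\<And>i k j. (Fm i k j \<longlongrightarrow> m i k j) at_top"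
      "\<And>i j. m i i j = \<sigma> j / \<beta> i"
      "\<And>i k j s. s \<ge> 0 \<Longrightarrow> (Fm i k j has_real_derivative \<sigma> j / (\<beta> i + s * \<sigma> j) * (\<sigma> j / (\<beta> k + s * \<sigma> j))) (at s)"
    by metis
  have "\<forall>i j l. \<exists>f. f 0 = (0::real) \<and> (f \<longlongrightarrow> log_kernel_const (\<sigma> j) (\<sigma> l) - ln (\<beta> i)) at_top \<and>
    (\<forall>s\<ge>0. (f has_real_derivative
      \<sigma> j / (\<beta> i + s * \<sigma> j) + \<sigma> l / (\<beta> i + s * \<sigma> l) - s * (\<sigma> j / (\<beta> i + s * \<sigma> j)) * (\<sigma> l / (\<beta> i + s * \<sigma> l)) - 1 / (1 + s)) (at s))"
    by (intro allI log_kernel_antiderivative pos)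
  then obtain Fg where Fg: "\<And>i j l. Fg i j l 0 = (0::real)"
      "\<And>i j l. (Fg i j l \<longlongrightarrow> log_kernel_const (\<sigma> j) (\<sigma> l) - \<gamma> i) at_top"
      "\<And>i j l s. s \<ge> 0 \<Longrightarrow> (Fg i j l has_real_derivative
      \<sigma> j / (\<beta> i + s * \<sigma> j) + \<sigma> l / (\<beta> i + s * \<sigma> l) - s * (\<sigma> j / (\<beta> i + s * \<sigma> j)) * (\<sigma> l / (\<beta> i + s * \<sigma> l)) - 1 / (1 + s)) (at s)"
    unfolding \<beta>_def ln_exp by metis
  \<comment> \<open>Entry by entry, \<open>N\<close> is the integral over s > 0 of
    \<open>\<zeta> ** mat_adjoint \<zeta>\<close> for the \<open>\<zeta>\<close> defined further
    down. Conjugation by \<open>B\<close> makes \<open>M\<close> the integral of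
    \<open>Z ** mat_adjoint Z\<close>.\<close>
  define N :: "complex ^ 'n ^ 'n"
    where "N = (\<chi> k i. \<Sum>j\<in>UNIV. p $ k $ j * cnj (p $ i $ j) * complex_of_real (m i k j))"
  define M where "M = B ** N ** mat_adjoint B"
  have retr_M: "retr (M ** A) = retr ((mat_adjoint B ** A ** B) ** N)" for A
  proof -
    have "retr (M ** A) = retr (B ** (N ** mat_adjoint B ** A))"
      by (simp add: M_def matrix_mul_assoc)
    also have "\<dots> = retr (N ** (mat_adjoint B ** A ** B))"
      by (subst retr_mult_commute) (simp add: matrix_mul_assoc)
    also have "\<dots> = retr ((mat_adjoint B ** A ** B) ** N)"
      by (rule retr_mult_commute)
    finally show ?thesis .
  qed
  have "retr (M ** mat_exp G) = retr (mat_exp (H + G))"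
  proof -
    have "mat_adjoint B ** mat_exp G ** B = diag_mat \<beta>"
    proof -
      have "mat_exp G = B ** diag_mat \<beta> ** mat_adjoint B"
        by (simp add: Geq mat_exp_spectral_mat[OF B] \<beta>_def[abs_def]) (simp add: spectral_mat_def)
      thus ?thesis
        using unitary_cancel[OF B, of "diag_mat \<beta> ** mat_adjoint B ** B"] unitary_cancel(4)[OF B, of "diag_mat \<beta>"]
        by (simp add: matrix_mul_assoc)
    qed
    hence "retr (M ** mat_exp G) = (\<Sum>i\<in>UNIV. \<beta> i * Re (N $ i $ i))"
      unfolding retr_M by (simp add: retr_def trace_def)
    also have "\<dots> = (\<Sum>i\<in>UNIV. \<Sum>j\<in>UNIV. (cmod (p $ i $ j))\<^sup>2 * \<sigma> j)"
    proof (intro sum.cong refl)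
      fix i
      have "N $ i $ i = (\<Sum>j\<in>UNIV. complex_of_real ((cmod (p $ i $ j))\<^sup>2 * (\<sigma> j / \<beta> i)))"
        by (simp add: N_def Fm flip: complex_norm_square)
      hence "Re (N $ i $ i) = (\<Sum>j\<in>UNIV. (cmod (p $ i $ j))\<^sup>2 * (\<sigma> j / \<beta> i))"
        by (simp only: Re_sum Re_complex_of_real)
      thus "\<beta> i * Re (N $ i $ i) = (\<Sum>j\<in>UNIV. (cmod (p $ i $ j))\<^sup>2 * \<sigma> j)"
        using pos(1)[of i] by (simp add: sum_distrib_left)
    qed
    also have "\<dots> = (\<Sum>i\<in>UNIV. \<Sum>j\<in>UNIV. (cmod (p $ i $ j))\<^sup>2 * (1 * \<sigma> j))" by simp
    also have "\<dots> = retr (spectral_mat B (\<lambda>_. 1) ** spectral_mat S \<sigma>)"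
      unfolding retr_spectral_mult p_def by (rule refl)
    also have "\<dots> = retr (mat_exp (H + G))"
      by (simp add: spectral_mat_one[OF B] HGeq mat_exp_spectral_mat[OF S] \<sigma>_def[abs_def])
    finally show ?thesis .
  qed
  moreover have "retr (mat_exp (H + X)) \<le> retr (M ** mat_exp X)" if X: "self_adjoint X" for X
  proof -
    obtain P x where P: "unitary P" and Xeq: "X = spectral_mat P x"
      using spectral_mat_exists[OF X] .
    obtain Q y where Q: "unitary Q" and HXeq: "H + X = spectral_mat Q y"
      using spectral_mat_exists[OF self_adjoint_add[OF H X]] .
    define \<alpha> where "\<alpha> i = exp (x i)" for i
    define \<tau> where "\<tau> j = exp (y j)" for j
    have pos': "\<alpha> i > 0" "\<tau> i > 0" for i by (simp_all add: \<alpha>_def \<tau>_def)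
    define A where "A = mat_exp X"
    define T where "T = mat_exp (H + X)"
    have Aeq: "A = spectral_mat P \<alpha>"
      by (simp add: A_def Xeq mat_exp_spectral_mat[OF P] \<alpha>_def[abs_def])
    have Teq: "T = spectral_mat Q \<tau>"
      unfolding T_def HXeq by (simp add: mat_exp_spectral_mat[OF Q] \<tau>_def[abs_def])
    define A' where "A' = mat_adjoint B ** A ** B"
    define T' where "T' = mat_adjoint S ** T ** S"
    define w where "w = mat_adjoint P ** Q"
    define q where "q i j l = Re (cnj (p $ i $ j) * p $ i $ l * T' $ l $ j)" for i j l
    define r where "r i k j = Re (cnj (p $ i $ j) * A' $ i $ k * p $ k $ j)" for i k j
    have T'_adj: "T' $ j $ l = cnj (T' $ l $ j)" for j l
    proof -
      have "mat_adjoint T' = T'"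
        using self_adjoint_spectral_mat[of Q \<tau>]
        by (simp add: T'_def Teq mat_adjoint_mult self_adjoint_def matrix_mul_assoc)
      thus ?thesis by (metis mat_adjoint_nth)
    qed
    have q_sym: "q i l j = q i j l" for i j l
      unfolding q_def T'_adj[of j l] by (simp add: algebra_simps)
    \<comment> \<open>For fixed \<open>s\<close>, \<open>?W\<close> bounds the functional \<open>2 *
      retr (mat_adjoint Z ** T) - retr (A ** Z ** mat_adjoint Z) - s * retr (T ** mat_adjoint Z **
      Z)\<close> over all \<open>Z\<close>, and \<open>?Q - ?R\<close> is its value at the
      \<open>Z\<close> that is optimal for \<open>X = G\<close>. The terms in
      \<open>1 / (1 + s)\<close> are added later.\<close>
    have pointwise: "0 \<le> (\<Sum>i\<in>UNIV. \<Sum>j\<in>UNIV. (cmod (w $ i $ j))\<^sup>2 * ((\<tau> j)\<^sup>2 / (\<alpha> i + s * \<tau> j)))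
      - (\<Sum>i\<in>UNIV. \<Sum>j\<in>UNIV. \<Sum>l\<in>UNIV. q i j l * (\<sigma> j / (\<beta> i + s * \<sigma> j) + \<sigma> l / (\<beta> i + s * \<sigma> l)
            - s * (\<sigma> j / (\<beta> i + s * \<sigma> j)) * (\<sigma> l / (\<beta> i + s * \<sigma> l))))
      + (\<Sum>i\<in>UNIV. \<Sum>k\<in>UNIV. \<Sum>j\<in>UNIV. r i k j * (\<sigma> j / (\<beta> i + s * \<sigma> j) * (\<sigma> j / (\<beta> k + s * \<sigma> j))))"
      (is "0 \<le> ?W - ?Q + ?R") if s: "s \<ge> 0" for s
    proof -
      define k where "k i j = \<sigma> j / (\<beta> i + s * \<sigma> j)" for i j
      \<comment> \<open>the minimiser of the quadratic form at the point of tangency, where \<open>X = G\<close>\<close>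
      define \<zeta> :: "complex ^ 'n ^ 'n" where "\<zeta> = (\<chi> i j. p $ i $ j * complex_of_real (k i j))"
      define Z where "Z = B ** \<zeta> ** mat_adjoint S"
      have Z_adj: "mat_adjoint Z = S ** mat_adjoint \<zeta> ** mat_adjoint B"
        by (simp add: Z_def mat_adjoint_mult matrix_mul_assoc)
      have t1: "retr (mat_adjoint Z ** T) = (\<Sum>i\<in>UNIV. \<Sum>j\<in>UNIV. \<Sum>l\<in>UNIV. q i j l * k i j)"
      proof -
        have "retr (mat_adjoint Z ** T) = retr (S ** (mat_adjoint \<zeta> ** (mat_adjoint B ** T)))"
          by (simp add: Z_adj matrix_mul_assoc)
        also have "\<dots> = retr (mat_adjoint \<zeta> ** (mat_adjoint B ** T ** S))"
          by (subst retr_mult_commute) (simp add: matrix_mul_assoc)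
        also have "mat_adjoint B ** T ** S = p ** T'"
          unfolding p_def T'_def using unitary_cancel(3)[OF S, of "mat_adjoint B"]
          by (simp add: matrix_mul_assoc)
        also have "retr (mat_adjoint \<zeta> ** (p ** T')) = (\<Sum>i\<in>UNIV. \<Sum>j\<in>UNIV. \<Sum>l\<in>UNIV. q i j l * k i j)"
          unfolding retr_adjoint_mult
        proof (intro sum.cong refl)
          fix i j
          have "cnj (\<zeta> $ i $ j) * (p ** T') $ i $ j
              = (\<Sum>l\<in>UNIV. (cnj (p $ i $ j) * p $ i $ l * T' $ l $ j) * complex_of_real (k i j))"
            by (simp add: \<zeta>_def matrix_matrix_mult_def sum_distrib_left mult_ac)
          thus "Re (cnj (\<zeta> $ i $ j) * (p ** T') $ i $ j) = (\<Sum>l\<in>UNIV. q i j l * k i j)"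
            by (simp add: q_def)
        qed
        finally show ?thesis .
      qed
      \<comment> \<open>By the symmetry of \<open>q\<close> in its last two indices, twice the
        linear term splits into one copy with \<open>k i j\<close> and one with
        \<open>k i l\<close>, as in the logarithmic kernel.\<close>
      have t1': "retr (mat_adjoint Z ** T) = (\<Sum>i\<in>UNIV. \<Sum>j\<in>UNIV. \<Sum>l\<in>UNIV. q i j l * k i l)"
        unfolding t1
      proof (rule sum.cong)
        fix i
        show "(\<Sum>j\<in>UNIV. \<Sum>l\<in>UNIV. q i j l * k i j) = (\<Sum>j\<in>UNIV. \<Sum>l\<in>UNIV. q i j l * k i l)"
          by (subst sum.swap) (simp add: q_sym)
      qed simp
      have t2: "retr (T ** mat_adjoint Z ** Z) = (\<Sum>i\<in>UNIV. \<Sum>j\<in>UNIV. \<Sum>l\<in>UNIV. q i j l * (k i j * k i l))"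
      proof -
        have "retr (T ** mat_adjoint Z ** Z) = retr (T ** S ** mat_adjoint \<zeta> ** (mat_adjoint B ** (B ** (\<zeta> ** mat_adjoint S))))"
          unfolding Z_adj by (simp add: Z_def matrix_mul_assoc)
        also have "\<dots> = retr ((T ** S) ** (mat_adjoint \<zeta> ** \<zeta> ** mat_adjoint S))"
          by (simp add: unitary_cancel[OF B] matrix_mul_assoc)
        also have "\<dots> = retr (mat_adjoint \<zeta> ** (\<zeta> ** T'))"
          by (subst retr_mult_commute) (simp add: T'_def matrix_mul_assoc)
        also have "\<dots> = (\<Sum>i\<in>UNIV. \<Sum>j\<in>UNIV. \<Sum>l\<in>UNIV. q i j l * (k i j * k i l))"
          unfolding retr_adjoint_mult
        proof (intro sum.cong refl)
          fix i j
          have "cnj (\<zeta> $ i $ j) * (\<zeta> ** T') $ i $ j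
              = (\<Sum>l\<in>UNIV. (cnj (p $ i $ j) * p $ i $ l * T' $ l $ j) * complex_of_real (k i j * k i l))"
            by (simp add: \<zeta>_def matrix_matrix_mult_def sum_distrib_left mult_ac)
          thus "Re (cnj (\<zeta> $ i $ j) * (\<zeta> ** T') $ i $ j) = (\<Sum>l\<in>UNIV. q i j l * (k i j * k i l))"
            by (simp add: q_def del: of_real_mult)
        qed
        finally show ?thesis .
      qed
      have t3: "retr (A ** Z ** mat_adjoint Z) = (\<Sum>i\<in>UNIV. \<Sum>h\<in>UNIV. \<Sum>j\<in>UNIV. r i h j * (k i j * k h j))"
      proof -
        have "retr (A ** Z ** mat_adjoint Z) = retr (A ** B ** \<zeta> ** (mat_adjoint S ** (S ** (mat_adjoint \<zeta> ** mat_adjoint B))))"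
          unfolding Z_adj by (simp add: Z_def matrix_mul_assoc)
        also have "\<dots> = retr ((A ** B ** \<zeta>) ** (mat_adjoint \<zeta> ** mat_adjoint B))"
          by (simp add: unitary_cancel[OF S] matrix_mul_assoc)
        also have "\<dots> = retr (mat_adjoint \<zeta> ** (A' ** \<zeta>))"
          by (subst retr_mult_commute) (simp add: A'_def matrix_mul_assoc)
        also have "\<dots> = (\<Sum>i\<in>UNIV. \<Sum>j\<in>UNIV. \<Sum>h\<in>UNIV. r i h j * (k i j * k h j))"
          unfolding retr_adjoint_mult
        proof (intro sum.cong refl)
          fix i j
          have "cnj (\<zeta> $ i $ j) * (A' ** \<zeta>) $ i $ j
              = (\<Sum>h\<in>UNIV. (cnj (p $ i $ j) * A' $ i $ h * p $ h $ j) * complex_of_real (k i j * k h j))"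
            by (simp add: \<zeta>_def matrix_matrix_mult_def sum_distrib_left mult_ac)
          thus "Re (cnj (\<zeta> $ i $ j) * (A' ** \<zeta>) $ i $ j) = (\<Sum>h\<in>UNIV. r i h j * (k i j * k h j))"
            by (simp add: r_def del: of_real_mult)
        qed
        also have "\<dots> = (\<Sum>i\<in>UNIV. \<Sum>h\<in>UNIV. \<Sum>j\<in>UNIV. r i h j * (k i j * k h j))"
          by (intro sum.cong refl sum.swap)
        finally show ?thesis .
      qed
      have "2 * retr (mat_adjoint Z ** T) - retr (A ** Z ** mat_adjoint Z) - s * retr (T ** mat_adjoint Z ** Z) \<le> ?W"
        unfolding Aeq Teq w_def by (intro quadratic_lower_bound P Q pos' s)
      moreover have "?Q = 2 * retr (mat_adjoint Z ** T) - s * retr (T ** mat_adjoint Z ** Z)"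
      proof -
        have "?Q = (\<Sum>i\<in>UNIV. \<Sum>j\<in>UNIV. \<Sum>l\<in>UNIV. q i j l * k i j) + (\<Sum>i\<in>UNIV. \<Sum>j\<in>UNIV. \<Sum>l\<in>UNIV. q i j l * k i l)
            - s * (\<Sum>i\<in>UNIV. \<Sum>j\<in>UNIV. \<Sum>l\<in>UNIV. q i j l * (k i j * k i l))"
          unfolding sum_distrib_left sum.distrib[symmetric] sum_subtractf[symmetric]
          by (intro sum.cong refl) (simp add: k_def algebra_simps)
        thus ?thesis using t1 t1' t2 by simp
      qed
      moreover have "?R = retr (A ** Z ** mat_adjoint Z)" unfolding t3 k_def by (rule refl)
      ultimately show ?thesis by linarith
    qed
    have "\<forall>i j. \<exists>f. f 0 = (0::real) \<and> (f \<longlongrightarrow> \<tau> j * (ln (\<tau> j) - ln (\<alpha> i))) at_top \<and>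
      (\<forall>s\<ge>0. (f has_real_derivative (\<tau> j)\<^sup>2 / (\<alpha> i + s * \<tau> j) - \<tau> j / (1 + s)) (at s))"
      by (intro allI square_kernel_antiderivative pos')
    then obtain Fw where Fw: "\<And>i j. Fw i j 0 = (0::real)"
        "\<And>i j. (Fw i j \<longlongrightarrow> \<tau> j * (y j - x i)) at_top"
        "\<And>i j s. s \<ge> 0 \<Longrightarrow> (Fw i j has_real_derivative (\<tau> j)\<^sup>2 / (\<alpha> i + s * \<tau> j) - \<tau> j / (1 + s)) (at s)"
      unfolding \<tau>_def \<alpha>_def ln_exp by metis
    \<comment> \<open>The antiderivative in \<open>s\<close> of the pointwise difference,
      normalising terms included; its limit \<open>L\<close> is the integrated inequality.\<close>
    define \<Psi> where "\<Psi> s = (\<Sum>i\<in>UNIV. \<Sum>j\<in>UNIV. (cmod (w $ i $ j))\<^sup>2 * Fw i j s)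
      - (\<Sum>i\<in>UNIV. \<Sum>j\<in>UNIV. \<Sum>l\<in>UNIV. q i j l * Fg i j l s)
      + (\<Sum>i\<in>UNIV. \<Sum>k\<in>UNIV. \<Sum>j\<in>UNIV. r i k j * Fm i k j s)" for s
    define \<Psi>' where "\<Psi>' s = (\<Sum>i\<in>UNIV. \<Sum>j\<in>UNIV. (cmod (w $ i $ j))\<^sup>2 * ((\<tau> j)\<^sup>2 / (\<alpha> i + s * \<tau> j) - \<tau> j / (1 + s)))
      - (\<Sum>i\<in>UNIV. \<Sum>j\<in>UNIV. \<Sum>l\<in>UNIV. q i j l * (\<sigma> j / (\<beta> i + s * \<sigma> j) + \<sigma> l / (\<beta> i + s * \<sigma> l)
            - s * (\<sigma> j / (\<beta> i + s * \<sigma> j)) * (\<sigma> l / (\<beta> i + s * \<sigma> l)) - 1 / (1 + s)))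
      + (\<Sum>i\<in>UNIV. \<Sum>k\<in>UNIV. \<Sum>j\<in>UNIV. r i k j * (\<sigma> j / (\<beta> i + s * \<sigma> j) * (\<sigma> j / (\<beta> k + s * \<sigma> j))))" for s
    define L where "L = (\<Sum>i\<in>UNIV. \<Sum>j\<in>UNIV. (cmod (w $ i $ j))\<^sup>2 * (\<tau> j * (y j - x i)))
      - (\<Sum>i\<in>UNIV. \<Sum>j\<in>UNIV. \<Sum>l\<in>UNIV. q i j l * (log_kernel_const (\<sigma> j) (\<sigma> l) - \<gamma> i))
      + (\<Sum>i\<in>UNIV. \<Sum>k\<in>UNIV. \<Sum>j\<in>UNIV. r i k j * m i k j)"
    have sum_w: "(\<Sum>i\<in>UNIV. \<Sum>j\<in>UNIV. (cmod (w $ i $ j))\<^sup>2 * (\<tau> j * e j)) = (\<Sum>j\<in>UNIV. \<tau> j * e j)" for e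
      using retr_spectral_mult[of P "\<lambda>_. 1" Q "\<lambda>j. \<tau> j * e j"]
      by (simp add: spectral_mat_one[OF P] retr_spectral_mat[OF Q] w_def)
    have retr_T: "retr T = (\<Sum>j\<in>UNIV. \<tau> j)" by (simp add: Teq retr_spectral_mat[OF Q])
    \<comment> \<open>Summation over \<open>i\<close> uses the unitarity of \<open>p\<close> and
      leaves only \<open>j = l\<close>. Hence only the diagonal values \<open>ln a + 1\<close> of
      the logarithmic kernel survive, which produce
      \<open>retr (T ** (H + G)) + retr T\<close>.\<close>
    have sum_q: "(\<Sum>i\<in>UNIV. \<Sum>j\<in>UNIV. \<Sum>l\<in>UNIV. q i j l * e j l) = (\<Sum>j\<in>UNIV. e j j * Re (T' $ j $ j))" for e
    proof -
      have "(\<Sum>i\<in>UNIV. \<Sum>j\<in>UNIV. \<Sum>l\<in>UNIV. q i j l * e j l) = (\<Sum>j\<in>UNIV. \<Sum>i\<in>UNIV. \<Sum>l\<in>UNIV. q i j l * e j l)"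
        by (rule sum.swap)
      also have "\<dots> = (\<Sum>j\<in>UNIV. \<Sum>l\<in>UNIV. \<Sum>i\<in>UNIV. q i j l * e j l)"
        by (intro sum.cong refl sum.swap)
      also have "\<dots> = (\<Sum>j\<in>UNIV. \<Sum>l\<in>UNIV. if l = j then e j j * Re (T' $ j $ j) else 0)"
      proof (intro sum.cong refl)
        fix j l
        have "(\<Sum>i\<in>UNIV. q i j l * e j l) = Re ((\<Sum>i\<in>UNIV. cnj (p $ i $ j) * p $ i $ l) * T' $ l $ j) * e j l"
          by (simp add: q_def sum_distrib_right del: Re_sum) (simp add: sum_distrib_right)
        also have "(\<Sum>i\<in>UNIV. cnj (p $ i $ j) * p $ i $ l) = (mat_adjoint p ** p) $ j $ l"
          by (simp add: matrix_matrix_mult_def)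
        finally show "(\<Sum>i\<in>UNIV. q i j l * e j l) = (if l = j then e j j * Re (T' $ j $ j) else 0)"
          using p_unitary by (auto simp: unitary_def mat_def)
      qed
      finally show ?thesis by simp
    qed
    have retr_T': "(\<Sum>j\<in>UNIV. Re (T' $ j $ j)) = retr T"
      using retr_mult_spectral_mat[of T S "\<lambda>_. 1"] by (simp add: spectral_mat_one[OF S] T'_def)
    have "L \<ge> 0"
    proof (rule nondecreasing_limit_nonneg)
      show "\<Psi> 0 = 0" by (simp add: \<Psi>_def Fm Fg Fw)
      show "(\<Psi> \<longlongrightarrow> L) at_top"
        unfolding \<Psi>_def[abs_def] L_def by (intro tendsto_intros Fm Fg Fw)
      show "(\<Psi> has_real_derivative \<Psi>' s) (at s)" if "s \<ge> 0" for s
        unfolding \<Psi>_def[abs_def] \<Psi>'_def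
        by (intro DERIV_add DERIV_diff DERIV_sum DERIV_cmult Fm Fg Fw that)
      show "\<Psi>' s \<ge> 0" if "s \<ge> 0" for s
      proof -
        \<comment> \<open>Both normalising terms contribute \<open>retr T / (1 + s)\<close> and
          cancel, which reduces the claim to \<open>pointwise\<close>.\<close>
        have "(\<Sum>i\<in>UNIV. \<Sum>j\<in>UNIV. (cmod (w $ i $ j))\<^sup>2 * (\<tau> j * (1 / (1 + s)))) = retr T * (1 / (1 + s))"
          unfolding sum_w retr_T by (simp add: sum_divide_distrib)
        moreover have "(\<Sum>i\<in>UNIV. \<Sum>j\<in>UNIV. \<Sum>l\<in>UNIV. q i j l * (1 / (1 + s))) = retr T * (1 / (1 + s))"
          unfolding sum_q retr_T'[symmetric] by (simp add: sum_divide_distrib)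
        ultimately show ?thesis
          using pointwise[OF that] unfolding \<Psi>'_def right_diff_distrib[of _ _ "1 / (1 + s)"]
            right_diff_distrib[of _ _ "\<tau> _ / (1 + s)"] sum_subtractf by simp
      qed
    qed
    moreover have "(\<Sum>i\<in>UNIV. \<Sum>j\<in>UNIV. (cmod (w $ i $ j))\<^sup>2 * (\<tau> j * (y j - x i))) = retr (T ** (H + X)) - retr (T ** X)"
    proof -
      have "retr (T ** X) = (\<Sum>i\<in>UNIV. \<Sum>j\<in>UNIV. (cmod (w $ i $ j))\<^sup>2 * (\<tau> j * x i))"
        unfolding Teq Xeq by (subst retr_mult_commute) (simp add: retr_spectral_mult w_def mult_ac)
      moreover have "retr (T ** (H + X)) = (\<Sum>i\<in>UNIV. \<Sum>j\<in>UNIV. (cmod (w $ i $ j))\<^sup>2 * (\<tau> j * y j))"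
        unfolding Teq HXeq sum_w by (simp add: spectral_mat_mult[OF Q] retr_spectral_mat[OF Q])
      ultimately show ?thesis by (simp add: right_diff_distrib sum_subtractf)
    qed
    moreover have "(\<Sum>i\<in>UNIV. \<Sum>j\<in>UNIV. \<Sum>l\<in>UNIV. q i j l * (log_kernel_const (\<sigma> j) (\<sigma> l) - \<gamma> i))
        = retr (T ** (H + G)) + retr T - retr (T ** G)"
    proof -
      have "(\<Sum>j\<in>UNIV. log_kernel_const (\<sigma> j) (\<sigma> j) * Re (T' $ j $ j)) = retr (T ** (H + G)) + retr T"
        unfolding HGeq retr_mult_spectral_mat retr_T'[symmetric] T'_def[symmetric]
        by (simp add: log_kernel_const_def \<sigma>_def distrib_right sum.distrib)
      moreover have "(\<Sum>i\<in>UNIV. \<Sum>j\<in>UNIV. \<Sum>l\<in>UNIV. q i j l * \<gamma> i) = retr (T ** G)"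
      proof -
        have "p ** T' ** mat_adjoint p = mat_adjoint B ** T ** B"
        proof -
          have "p ** T' ** mat_adjoint p
              = mat_adjoint B ** (S ** (mat_adjoint S ** (T ** (S ** (mat_adjoint S ** B)))))"
            by (simp add: p_def T'_def mat_adjoint_mult matrix_mul_assoc)
          thus ?thesis by (simp add: unitary_cancel[OF S] matrix_mul_assoc)
        qed
        moreover have "Re ((p ** T' ** mat_adjoint p) $ i $ i) = (\<Sum>j\<in>UNIV. \<Sum>l\<in>UNIV. q i j l)" for i
        proof -
          have "(p ** T' ** mat_adjoint p) $ i $ i
              = (\<Sum>j\<in>UNIV. \<Sum>l\<in>UNIV. cnj (p $ i $ j) * p $ i $ l * T' $ l $ j)"
            by (simp add: matrix_matrix_mult_def sum_distrib_left sum_distrib_right mult_ac)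
          thus ?thesis by (simp only: q_def Re_sum)
        qed
        ultimately show ?thesis
          unfolding Geq retr_mult_spectral_mat by (simp add: sum_distrib_left mult.commute)
      qed
      ultimately show ?thesis
        by (simp add: right_diff_distrib sum_subtractf sum_q)
    qed
    moreover have "(\<Sum>i\<in>UNIV. \<Sum>k\<in>UNIV. \<Sum>j\<in>UNIV. r i k j * m i k j) = retr (M ** A)"
    proof -
      have "(\<Sum>j\<in>UNIV. r i k j * m i k j) = Re (A' $ i $ k * N $ k $ i)" for i k
      proof -
        have "A' $ i $ k * N $ k $ i = (\<Sum>j\<in>UNIV. cnj (p $ i $ j) * A' $ i $ k * p $ k $ j * complex_of_real (m i k j))"
          by (simp add: N_def sum_distrib_left mult_ac)
        thus ?thesis by (simp add: r_def)
      qed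
      moreover have "retr (M ** A) = (\<Sum>i\<in>UNIV. \<Sum>k\<in>UNIV. Re (A' $ i $ k * N $ k $ i))"
        unfolding retr_M A'_def[symmetric] by (simp add: retr_def trace_def matrix_matrix_mult_def)
      ultimately show ?thesis by simp
    qed
    \<comment> \<open>The terms in \<open>X\<close> and in \<open>G\<close> cancel, each pair
      leaving \<open>retr (T ** H)\<close>; what remains is
      \<open>retr T \<le> retr (M ** A)\<close>.\<close>
    ultimately have "0 \<le> retr (T ** (H + X)) - retr (T ** X) - (retr (T ** (H + G)) + retr T - retr (T ** G)) + retr (M ** A)"
      unfolding L_def by simp
    thus ?thesis
      by (simp add: matrix_add_ldistrib retr_add flip: A_def T_def)
  qed
  ultimately show ?thesis using that by blast
qed

section \<open>Supporting functionals and operator inequalities\<close>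

text \<open>A chosen version of a matrix conditional expectation need not be self-adjoint at every
  point. Passing to the Hermitian part repairs this and changes neither quadratic forms nor real
  traces against self-adjoint matrices.\<close>

definition herm_part :: "complex ^ 'n ^ 'n \<Rightarrow> complex ^ 'n ^ 'n" where
  "herm_part A = (1 / 2) *\<^sub>R (A + mat_adjoint A)"

lemma self_adjoint_herm_part [simp]: "self_adjoint (herm_part A)"
  by (simp add: self_adjoint_def herm_part_def mat_adjoint_scaleR mat_adjoint_add add.commute)

lemma herm_part_add: "herm_part (A + B) = herm_part A + herm_part B"
  by (simp add: herm_part_def mat_adjoint_add algebra_simps)

lemma herm_part_0 [simp]: "herm_part 0 = 0"
  by (simp add: herm_part_def vec_eq_iff)

lemma qform_add_mat: "qform (A + B) v = qform A v + qform B v"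
  by (simp add: matrix_vector_mult_add_rdistrib inner_add_right)

lemma qform_diff_mat: "qform (A - B) v = qform A v - qform B v"
  by (simp add: matrix_vector_mult_diff_rdistrib inner_diff_right)

lemma qform_mat_adjoint: "qform (mat_adjoint A) v = qform A v"
  by (metis inner_mat_adjoint inner_commute)

lemma qform_herm_part: "qform (herm_part A) v = qform A v"
  by (simp add: herm_part_def qform_scaleR_mat qform_add_mat qform_mat_adjoint)

lemma retr_mat_adjoint: "retr (mat_adjoint A) = retr A"
  by (simp add: retr_def trace_def)

lemma mult_scaleR_mat: "A ** (c *\<^sub>R B) = c *\<^sub>R (A ** B)" "(c *\<^sub>R A) ** B = c *\<^sub>R (A ** B)"
  for A :: "complex ^ 'n ^ 'n"
  by (simp_all add: vec_eq_iff matrix_matrix_mult_def scaleR_sum_right)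

lemma retr_mult_herm_part:
  assumes "self_adjoint A" shows "retr (A ** herm_part B) = retr (A ** B)" "retr (herm_part B ** A) = retr (B ** A)"
proof -
  have "retr (A ** mat_adjoint B) = retr (mat_adjoint (B ** A))"
    using assms by (simp add: mat_adjoint_mult self_adjoint_def)
  also have "\<dots> = retr (A ** B)" unfolding retr_mat_adjoint by (rule retr_mult_commute)
  finally show "retr (A ** herm_part B) = retr (A ** B)"
    by (simp add: herm_part_def mult_scaleR_mat matrix_add_ldistrib retr_add retr_scaleR)
  thus "retr (herm_part B ** A) = retr (B ** A)"
    by (simp add: retr_mult_commute[of _ A])
qed

text \<open>Every positive definite matrix is an exponential.\<close>

lemma retr_mult_nonneg:
  assumes M: "\<And>X. self_adjoint X \<Longrightarrow> 0 \<le> retr (M ** mat_exp X)"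
    and P: "self_adjoint P" "\<And>v. 0 \<le> qform P v"
  shows "0 \<le> retr (M ** P)"
proof (rule field_le_epsilon)
  fix e :: real assume e: "e > 0"
  obtain U d where U: "unitary U" and Peq: "P = spectral_mat U d"
    using spectral_mat_exists[OF P(1)] .
  have d: "d k \<ge> 0" for k
    using P(2)[of "column k U"] by (simp add: Peq qform_spectral_mat_column[OF U])
  \<comment> \<open>A shift that makes \<open>P\<close> positive definite, so that it has a
    logarithm, scaled so that it changes the trace by at most \<open>e\<close>.\<close>
  define c where "c = e / (\<bar>retr M\<bar> + 1)"
  have c: "c > 0" using e by (simp add: c_def add_nonneg_pos)
  have "mat_exp (spectral_mat U (\<lambda>k. ln (d k + c))) = P + c *\<^sub>R mat 1"
    using d c by (simp add: mat_exp_spectral_mat[OF U] Peq spectral_mat_add add_nonneg_pos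
        flip: spectral_mat_const[OF U])
  with M[OF self_adjoint_spectral_mat] have "0 \<le> retr (M ** (P + c *\<^sub>R mat 1))" by metis
  also have "\<dots> = retr (M ** P) + c * retr M"
    by (simp add: matrix_add_ldistrib retr_add mult_scaleR_mat retr_scaleR)
  also have "c * retr M \<le> e"
  proof -
    have "c * retr M \<le> c * (\<bar>retr M\<bar> + 1)" using c by (intro mult_left_mono) auto
    thus ?thesis using e by (simp add: c_def)
  qed
  finally show "0 \<le> retr (M ** P) + e" by simp
qed

text \<open>The functional dominates traces of exponentials, so it is nonnegative on all
  exponentials, hence on all positive semidefinite matrices; this is its monotonicity in the Loewner
  order.\<close>

corollary Lieb_supporting_functional:
  fixes H G :: "complex ^ 'n ^ 'n"
  assumes H: "self_adjoint H" and G: "self_adjoint G"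
  obtains M where "self_adjoint M" "retr (M ** mat_exp G) = retr (mat_exp (H + G))"
    and "\<And>X. self_adjoint X \<Longrightarrow> retr (mat_exp (H + X)) \<le> retr (M ** mat_exp X)"
    and "\<And>P Q. self_adjoint P \<Longrightarrow> self_adjoint Q \<Longrightarrow> (\<And>v. qform P v \<le> qform Q v) \<Longrightarrow> retr (M ** P) \<le> retr (M ** Q)"
proof -
  obtain M where
    M: "retr (M ** mat_exp G) = retr (mat_exp (H + G))"
      "\<And>X. self_adjoint X \<Longrightarrow> retr (mat_exp (H + X)) \<le> retr (M ** mat_exp X)"
    using Lieb_tangent_functional[OF H G] by blast
  have herm: "retr (herm_part M ** mat_exp X) = retr (M ** mat_exp X)" if "self_adjoint X" for X
    by (intro retr_mult_herm_part self_adjoint_mat_exp that)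
  have mono: "retr (herm_part M ** P) \<le> retr (herm_part M ** Q)"
    if PQ: "self_adjoint P" "self_adjoint Q" "\<And>v. qform P v \<le> qform Q v" for P Q
  proof -
    have "0 \<le> retr (herm_part M ** (Q - P))"
    proof (rule retr_mult_nonneg)
      fix X :: "complex ^ 'n ^ 'n" assume X: "self_adjoint X"
      show "0 \<le> retr (herm_part M ** mat_exp X)"
        using M(2)[OF X] retr_mat_exp_nonneg[OF self_adjoint_add[OF H X]] herm[OF X] by simp
    qed (use PQ in \<open>auto simp: self_adjoint_diff qform_diff_mat\<close>)
    moreover have "herm_part M ** Q = herm_part M ** P + herm_part M ** (Q - P)"
      by (simp flip: matrix_add_ldistrib)
    ultimately show ?thesis by (simp add: retr_add)
  qed
  show ?thesis
    using that[of "herm_part M"] M mono by (simp add: herm G)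
qed

text \<open>Bernstein's scalar estimate. For \<open>y \<le> 0\<close> the coefficient 1/2 suffices
  and the denominator, at most 1, only enlarges it. For \<open>y > 0\<close> the case
  \<open>c = y\<close> follows, with the denominator cleared, from two differentiations, and a
  larger \<open>c\<close> increases the right side.\<close>

lemma exp_le_quadratic:
  fixes y c :: real
  assumes "y \<le> c" "0 \<le> c" "c < 3"
  shows "exp y \<le> 1 + y + (y\<^sup>2 / 2) / (1 - c / 3)"
proof (cases "y \<le> 0")
  case True
  define f where "f x = 1 + x + x\<^sup>2 / 2 - exp x" for x :: real
  have "f 0 \<le> f y"
  proof (rule DERIV_nonpos_imp_nonincreasing[OF True])
    fix x :: real assume x: "y \<le> x" "x \<le> 0"
    have "(f has_real_derivative 1 + x - exp x) (at x)"
      unfolding f_def by (auto intro!: derivative_eq_intros)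
    moreover have "1 + x - exp x \<le> 0" using exp_ge_add_one_self[of x] by linarith
    ultimately show "\<exists>z. (f has_real_derivative z) (at x) \<and> z \<le> 0" by blast
  qed
  hence "exp y \<le> 1 + y + y\<^sup>2 / 2" by (simp add: f_def)
  also have "y\<^sup>2 / 2 \<le> (y\<^sup>2 / 2) / (1 - c / 3)"
    using assms divide_left_mono[of "1 - c / 3" 1 "y\<^sup>2 / 2"] by simp
  finally show ?thesis by simp
next
  case False
  define f where "f x = x\<^sup>2 / 2 + (1 + x - exp x) * (1 - x / 3)" for x :: real
  define f' where "f' x = x + (1 - exp x) * (1 - x / 3) - (1 + x - exp x) / 3" for x :: real
  have f': "f' x \<ge> 0" if "x \<ge> 0" for x
  proof -
    have "f' 0 \<le> f' x"
    proof (rule DERIV_nonneg_imp_nondecreasing[OF that])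
      fix z :: real assume z: "0 \<le> z" "z \<le> x"
      have "(f' has_real_derivative (1 - exp z * (1 - z)) / 3) (at z)"
        unfolding f'_def by (auto intro!: derivative_eq_intros simp: field_simps)
      moreover have "exp z * (1 - z) \<le> exp z * exp (- z)"
        using exp_ge_add_one_self[of "- z"] by (intro mult_left_mono) auto
      hence "(1 - exp z * (1 - z)) / 3 \<ge> 0" by (simp flip: exp_add)
      ultimately show "\<exists>y. (f' has_real_derivative y) (at z) \<and> y \<ge> 0" by blast
    qed
    thus ?thesis by (simp add: f'_def)
  qed
  have "0 \<le> y" using False by simp
  have "f 0 \<le> f y"
  proof (rule DERIV_nonneg_imp_nondecreasing[OF \<open>0 \<le> y\<close>])
    fix x :: real assume x: "0 \<le> x" "x \<le> y"
    have "(f has_real_derivative f' x) (at x)"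
      unfolding f_def f'_def by (auto intro!: derivative_eq_intros simp: field_simps)
    thus "\<exists>z. (f has_real_derivative z) (at x) \<and> z \<ge> 0" using f'[OF x(1)] by blast
  qed
  hence "0 \<le> y\<^sup>2 / 2 + (1 + y - exp y) * (1 - y / 3)" by (simp add: f_def)
  moreover have "(1 + y - exp y) * (1 - y / 3) = - ((exp y - (1 + y)) * (1 - y / 3))" by algebra
  ultimately have "(exp y - (1 + y)) * (1 - y / 3) \<le> y\<^sup>2 / 2" by linarith
  moreover have "(exp y - (1 + y)) * (1 - c / 3) \<le> (exp y - (1 + y)) * (1 - y / 3)"
    using assms exp_ge_add_one_self[of y] by (intro mult_left_mono) auto
  ultimately have "(exp y - (1 + y)) * (1 - c / 3) \<le> y\<^sup>2 / 2" by linarith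
  hence "exp y - (1 + y) \<le> (y\<^sup>2 / 2) / (1 - c / 3)"
    by (subst pos_le_divide_eq) (use assms in auto)
  thus ?thesis by simp
qed

text \<open>The scalar estimate is applied to each eigenvalue of \<open>X\<close>. It bounds its
  argument from above only, which matches a hypothesis on \<open>lambda_max\<close>.\<close>

lemma qform_mat_exp_le_quadratic:
  assumes X: "self_adjoint X" "lambda_max X \<le> R" and R: "0 \<le> R" "0 \<le> \<theta>" "\<theta> * R < 3"
  shows "qform (mat_exp (\<theta> *\<^sub>R X)) v
    \<le> qform (mat 1 + \<theta> *\<^sub>R X + ((\<theta>\<^sup>2 / 2) / (1 - \<theta> * R / 3)) *\<^sub>R (X ** X)) v"
proof -
  obtain U d where U: "unitary U" and Xeq: "X = spectral_mat U d"
    using spectral_mat_exists[OF X(1)] .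
  define g where "g = (\<theta>\<^sup>2 / 2) / (1 - \<theta> * R / 3)"
  have d: "d k \<le> R" for k
  proof -
    have "d k \<le> Max (range d)" by (intro Max_ge) auto
    thus ?thesis using X(2) by (simp add: Xeq lambda_max_spectral_mat[OF U])
  qed
  have "qform (mat_exp (\<theta> *\<^sub>R X)) v \<le> qform (spectral_mat U (\<lambda>k. 1 + \<theta> * d k + g * (d k * d k))) v"
    unfolding Xeq spectral_mat_scaleR mat_exp_spectral_mat[OF U] qform_spectral_mat
  proof (intro sum_mono mult_right_mono)
    fix k
    have "\<theta> * d k \<le> \<theta> * R" "0 \<le> \<theta> * R" using d[of k] R by (auto intro: mult_left_mono)
    from exp_le_quadratic[OF this R(3)]
    show "exp (\<theta> * d k) \<le> 1 + \<theta> * d k + g * (d k * d k)"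
      by (simp add: g_def power2_eq_square mult_ac)
  qed auto
  also have "spectral_mat U (\<lambda>k. 1 + \<theta> * d k + g * (d k * d k)) = mat 1 + \<theta> *\<^sub>R X + g *\<^sub>R (X ** X)"
    by (simp add: Xeq spectral_mat_scaleR spectral_mat_mult[OF U] spectral_mat_add
        flip: spectral_mat_one[OF U])
  finally show ?thesis by (simp add: g_def)
qed

lemma qform_one_add_le_mat_exp:
  assumes "self_adjoint A" shows "qform (mat 1 + A) v \<le> qform (mat_exp A) v"
proof -
  obtain U d where U: "unitary U" and A: "A = spectral_mat U d"
    using spectral_mat_exists[OF assms] .
  have "mat 1 + A = spectral_mat U (\<lambda>k. 1 + d k)"
    by (simp add: A spectral_mat_add flip: spectral_mat_one[OF U])
  thus ?thesis
    unfolding A mat_exp_spectral_mat[OF U] by (simp only: qform_spectral_mat)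
      (intro sum_mono mult_right_mono, auto)
qed

text \<open>The norm of the matrix type is the Frobenius norm; Cauchy-Schwarz is used row by
  row.\<close>

lemma norm_mat_vec_mult_le:
  fixes A :: "complex ^ 'n ^ 'm"
  shows "norm (A *v v) \<le> norm A * norm v"
proof -
  have "cmod ((A *v v) $ i) \<le> norm (A $ i) * norm v" for i
  proof -
    have "cmod ((A *v v) $ i) \<le> (\<Sum>j\<in>UNIV. \<bar>cmod (A $ i $ j)\<bar> * \<bar>cmod (v $ j)\<bar>)"
      unfolding matrix_vector_mult_def by (simp add: norm_mult sum_norm_le)
    also have "\<dots> \<le> norm (A $ i) * norm v"
      unfolding norm_vec_def by (rule L2_set_mult_ineq)
    finally show ?thesis .
  qed
  hence "norm (A *v v) \<le> L2_set (\<lambda>i. norm (A $ i) * norm v) UNIV"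
    unfolding norm_vec_def[of "A *v v"] by (intro L2_set_mono) auto
  also have "\<dots> = norm A * norm v" by (simp add: norm_vec_def[of A] L2_set_left_distrib)
  finally show ?thesis .
qed

text \<open>Turns metric closeness into a Loewner inequality with a scalar shift; this is how random
  matrices are replaced by constants on a cell.\<close>

lemma qform_le_add_dist:
  assumes "dist A B \<le> e"
  shows "qform A v \<le> qform (B + e *\<^sub>R mat 1) v"
proof -
  have "qform (A - B) v \<le> norm v * norm ((A - B) *v v)" by (rule norm_cauchy_schwarz)
  also have "\<dots> \<le> norm v * (norm (A - B) * norm v)"
    by (intro mult_left_mono norm_mat_vec_mult_le) auto
  also have "\<dots> = norm (A - B) * (norm v)\<^sup>2" by (simp add: power2_eq_square)
  also have "\<dots> \<le> e * (norm v)\<^sup>2"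
    using assms by (intro mult_right_mono) (auto simp: dist_norm)
  finally show ?thesis
    by (simp add: qform_diff_mat qform_add_mat qform_scaleR_mat power2_norm_eq_inner)
qed

section \<open>One step of the supermartingale\<close>

lemma borel_measurable_mat_nth [measurable (raw)]:
  fixes f :: "'a \<Rightarrow> complex ^ 'n ^ 'm"
  assumes "f \<in> borel_measurable M"
  shows "(\<lambda>x. f x $ i $ j) \<in> borel_measurable M"
proof -
  have "continuous_on UNIV (\<lambda>A :: complex ^ 'n ^ 'm. A $ i $ j)" by (intro continuous_intros)
  thus ?thesis using assms by (rule borel_measurable_continuous_on)
qed

lemma borel_measurable_matI:
  fixes f :: "'a \<Rightarrow> complex ^ 'n ^ 'm"
  assumes "\<And>i j. (\<lambda>x. f x $ i $ j) \<in> borel_measurable M"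
  shows "f \<in> borel_measurable M"
proof (rule borel_measurable_euclidean_space[THEN iffD2, rule_format])
  fix b :: "complex ^ 'n ^ 'm" assume "b \<in> Basis"
  then obtain i j u where b: "b = axis i (axis j u)" unfolding Basis_vec_def by blast
  have "(\<lambda>x. inner (f x $ i $ j) u) \<in> borel_measurable M"
    by (rule borel_measurable_inner[OF assms borel_measurable_const])
  thus "(\<lambda>x. inner (f x) b) \<in> borel_measurable M" by (simp add: b inner_axis)
qed

lemma borel_measurable_mat_mult [measurable (raw)]:
  fixes f :: "'a \<Rightarrow> complex ^ 'n ^ 'm" and g :: "'a \<Rightarrow> complex ^ 'k ^ 'n"
  assumes [measurable]: "f \<in> borel_measurable M" "g \<in> borel_measurable M"
  shows "(\<lambda>x. f x ** g x) \<in> borel_measurable M"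
  by (rule borel_measurable_matI) (simp add: matrix_matrix_mult_def)

lemma borel_measurable_herm_part [measurable (raw)]:
  assumes [measurable]: "f \<in> borel_measurable M"
  shows "(\<lambda>x. herm_part (f x)) \<in> borel_measurable M"
proof -
  have [measurable]: "cnj \<in> borel_measurable borel"
    by (intro borel_measurable_continuous_onI continuous_intros)
  show ?thesis by (rule borel_measurable_matI) (simp add: herm_part_def)
qed

lemma borel_measurable_retr [measurable (raw)]:
  assumes [measurable]: "f \<in> borel_measurable M"
  shows "(\<lambda>x. retr (f x)) \<in> borel_measurable M"
  unfolding retr_def trace_def by measurable

lemma borel_measurable_mat_pow [measurable (raw)]:
  assumes [measurable]: "f \<in> borel_measurable M"
  shows "(\<lambda>x. mat_pow (f x) n) \<in> borel_measurable M"
  by (induction n) simp_all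

lemma borel_measurable_mat_exp [measurable (raw)]:
  assumes [measurable]: "f \<in> borel_measurable M"
  shows "(\<lambda>x. mat_exp (f x)) \<in> borel_measurable M"
  by (rule borel_measurable_matI) (simp add: mat_exp_def suminf_eq_lim borel_measurable_lim_metric)

lemma borel_measurable_mat_cond_exp [measurable]: "mat_cond_exp M F f \<in> borel_measurable F"
proof -
  have "(\<lambda>\<omega>. mat_cond_exp M F f \<omega> $ i $ j) \<in> borel_measurable F" for i j
    by (subst borel_measurable_complex_iff) (simp add: mat_cond_exp_def)
  thus ?thesis by (rule borel_measurable_matI)
qed

lemma mat_cond_exp_entries:
  "Re (mat_cond_exp M G f x $ i $ j) = real_cond_exp M G (\<lambda>x. Re (f x $ i $ j)) x"
  "Im (mat_cond_exp M G f x $ i $ j) = real_cond_exp M G (\<lambda>x. Im (f x $ i $ j)) x"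
  by (simp_all add: mat_cond_exp_def)

lemma retr_mult_eq_sum:
  "retr (N ** A) = (\<Sum>i\<in>UNIV. \<Sum>k\<in>UNIV. Re (N $ i $ k) * Re (A $ k $ i) - Im (N $ i $ k) * Im (A $ k $ i))"
  by (simp add: retr_def trace_def matrix_matrix_mult_def)

text \<open>For deterministic \<open>N\<close> the trace is a real linear combination of the
  entries, so scalar integrals suffice.\<close>

lemma integrable_retr_mult:
  fixes N :: "complex ^ 'n ^ 'n"
  assumes "\<And>i j. integrable M (\<lambda>x. h x * Re (f x $ i $ j))" "\<And>i j. integrable M (\<lambda>x. h x * Im (f x $ i $ j))"
  shows "integrable M (\<lambda>x. h x * retr (N ** f x))"
    and "(\<integral>x. h x * retr (N ** f x) \<partial>M) = (\<Sum>i\<in>UNIV. \<Sum>k\<in>UNIV.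
        Re (N $ i $ k) * (\<integral>x. h x * Re (f x $ k $ i) \<partial>M) - Im (N $ i $ k) * (\<integral>x. h x * Im (f x $ k $ i) \<partial>M))"
proof -
  have eq: "h x * retr (N ** f x) = (\<Sum>i\<in>UNIV. \<Sum>k\<in>UNIV.
        Re (N $ i $ k) * (h x * Re (f x $ k $ i)) - Im (N $ i $ k) * (h x * Im (f x $ k $ i)))" for x
    unfolding retr_mult_eq_sum sum_distrib_left by (intro sum.cong refl) (simp add: algebra_simps)
  show "integrable M (\<lambda>x. h x * retr (N ** f x))"
    unfolding eq using assms by simp
  show "(\<integral>x. h x * retr (N ** f x) \<partial>M) = (\<Sum>i\<in>UNIV. \<Sum>k\<in>UNIV.
        Re (N $ i $ k) * (\<integral>x. h x * Re (f x $ k $ i) \<partial>M) - Im (N $ i $ k) * (\<integral>x. h x * Im (f x $ k $ i) \<partial>M))"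
    unfolding eq using assms by simp
qed

section \<open>Integration over sets of the conditioning sigma-algebra\<close>

context finite_measure_subalgebra
begin

lemma measurable_subalg: "f \<in> borel_measurable F \<Longrightarrow> f \<in> borel_measurable M"
  using measurable_from_subalg[OF subalg] by blast

text \<open>The squared increments are assumed to have conditional expectations, not to be
  integrable. Integrability holds locally, on sets of \<open>F\<close> where the conditional
  expectation of the modulus is bounded, because both have the same integral over such sets.\<close>

lemma integrable_indicator_mult:
  fixes f :: "'a \<Rightarrow> complex"
  assumes [measurable]: "f \<in> borel_measurable M" and C: "C \<in> sets F"
    and bound: "\<And>x. x \<in> C \<Longrightarrow> nn_cond_exp M F (\<lambda>x. ennreal (cmod (f x))) x \<le> ennreal m"
  shows "integrable M (\<lambda>x. indicator C x * Re (f x))" "integrable M (\<lambda>x. indicator C x * Im (f x))"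
proof -
  have [measurable]: "C \<in> sets M" using C subalg by (auto simp: subalgebra_def)
  have "(\<integral>\<^sup>+x. ennreal (norm (indicator C x *\<^sub>R f x)) \<partial>M) = (\<integral>\<^sup>+x. indicator C x * ennreal (cmod (f x)) \<partial>M)"
    by (intro nn_integral_cong) (auto simp: indicator_def)
  also have "\<dots> = (\<integral>\<^sup>+x. indicator C x * nn_cond_exp M F (\<lambda>x. ennreal (cmod (f x))) x \<partial>M)"
    by (rule nn_cond_exp_intg[symmetric]) (use C in measurable)
  also have "\<dots> \<le> (\<integral>\<^sup>+x. ennreal m \<partial>M)"
    by (intro nn_integral_mono) (use bound in \<open>auto simp: indicator_def\<close>)
  also have "\<dots> < \<infinity>"
    by (simp add: emeasure_eq_measure ennreal_mult_less_top)
  finally have *: "integrable M (\<lambda>x. indicator C x *\<^sub>R f x)"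
    by (intro integrableI_bounded) measurable
  show "integrable M (\<lambda>x. indicator C x * Re (f x))" "integrable M (\<lambda>x. indicator C x * Im (f x))"
    using integrable_Re[OF *] integrable_Im[OF *] by simp_all
qed

lemma integral_retr_mult_cond_exp:
  fixes f :: "'a \<Rightarrow> complex ^ 'n ^ 'n"
  assumes f [measurable]: "f \<in> borel_measurable M" and C: "C \<in> sets F"
    and bound: "\<And>i j x. x \<in> C \<Longrightarrow> nn_cond_exp M F (\<lambda>x. ennreal (cmod (f x $ i $ j))) x \<le> ennreal m"
  shows "integrable M (\<lambda>x. indicator C x * retr (N ** f x))"
    and "integrable M (\<lambda>x. indicator C x * retr (N ** mat_cond_exp M F f x))"
    and "(\<integral>x. indicator C x * retr (N ** mat_cond_exp M F f x) \<partial>M) = (\<integral>x. indicator C x * retr (N ** f x) \<partial>M)"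
proof -
  have ind: "indicator C \<in> borel_measurable F" using C by measurable
  have int: "integrable M (\<lambda>x. indicator C x * Re (f x $ i $ j))" "integrable M (\<lambda>x. indicator C x * Im (f x $ i $ j))" for i j
    by (rule integrable_indicator_mult[OF _ C bound], measurable)+
  note re = real_cond_exp_intg[OF int(1) ind] and im = real_cond_exp_intg[OF int(2) ind]
  show "integrable M (\<lambda>x. indicator C x * retr (N ** f x))"
    by (rule integrable_retr_mult[OF int])
  show "integrable M (\<lambda>x. indicator C x * retr (N ** mat_cond_exp M F f x))"
    by (rule integrable_retr_mult) (simp_all add: mat_cond_exp_entries re im)
  show "(\<integral>x. indicator C x * retr (N ** mat_cond_exp M F f x) \<partial>M) = (\<integral>x. indicator C x * retr (N ** f x) \<partial>M)"
    by (subst (1 2) integrable_retr_mult(2)) (simp_all add: mat_cond_exp_entries re im int)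
qed

end

text \<open>One time step: \<open>H\<close> is the exponent known beforehand and \<open>X\<close>
  the new increment. Centring is stated through integrals over sets of \<open>F\<close>, the form in
  which the cells use it.\<close>

locale freedman_increment = finite_measure_subalgebra M F
  for M F :: "'a measure" +
  fixes H X :: "'a \<Rightarrow> complex ^ 'n ^ 'n" and R \<theta> :: real
  assumes H_meas [measurable]: "H \<in> borel_measurable F"
    and H_self_adjoint: "\<omega> \<in> space M \<Longrightarrow> self_adjoint (H \<omega>)"
    and X_meas [measurable]: "X \<in> borel_measurable M"
    and X_self_adjoint: "\<omega> \<in> space M \<Longrightarrow> self_adjoint (X \<omega>)"
    and X_le: "AE \<omega> in M. lambda_max (X \<omega>) \<le> R"
    and X_integrable: "C \<in> sets F \<Longrightarrow> integrable M (\<lambda>\<omega>. indicator C \<omega> * Re (X \<omega> $ i $ j))"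
      "C \<in> sets F \<Longrightarrow> integrable M (\<lambda>\<omega>. indicator C \<omega> * Im (X \<omega> $ i $ j))"
    and X_centered: "C \<in> sets F \<Longrightarrow> (\<integral>\<omega>. indicator C \<omega> * Re (X \<omega> $ i $ j) \<partial>M) = 0"
      "C \<in> sets F \<Longrightarrow> (\<integral>\<omega>. indicator C \<omega> * Im (X \<omega> $ i $ j) \<partial>M) = 0"
    and X2_exists: "mat_cond_exp_exists M F (\<lambda>\<omega>. X \<omega> ** X \<omega>)"
    and R_nonneg: "0 \<le> R" and \<theta>_nonneg: "0 \<le> \<theta>" and \<theta>_less: "\<theta> * R < 3"
begin

definition g :: real where "g = (\<theta>\<^sup>2 / 2) / (1 - \<theta> * R / 3)"

definition V :: "'a \<Rightarrow> complex ^ 'n ^ 'n" where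
  "V \<omega> = herm_part (mat_cond_exp M F (\<lambda>\<omega>. X \<omega> ** X \<omega>) \<omega>)"

lemma V_meas [measurable]: "V \<in> borel_measurable F"
  unfolding V_def[abs_def] by measurable

lemma V_self_adjoint: "self_adjoint (V \<omega>)"
  by (simp add: V_def)

text \<open>On \<open>C\<close> the matrices \<open>H - g V\<close> and \<open>g V\<close> stay
  within \<open>e\<close> of constants, so one deterministic functional \<open>N\<close>, tangent at
  \<open>G1\<close>, serves the whole cell. Each of the two approximations costs
  \<open>2 * e\<close>, half on passing to the constant and half on returning, whence the factor
  \<open>exp (4 * e)\<close>.\<close>

lemma step_on_cell:
  assumes C: "C \<in> sets F"
    and K: "\<And>\<omega>. \<omega> \<in> C \<Longrightarrow> dist (H \<omega> - g *\<^sub>R V \<omega>) K0 \<le> e"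
    and G: "\<And>\<omega>. \<omega> \<in> C \<Longrightarrow> dist (g *\<^sub>R V \<omega>) G0 \<le> e"
    and bound: "\<And>i j \<omega>. \<omega> \<in> C \<Longrightarrow> nn_cond_exp M F (\<lambda>\<omega>. ennreal (cmod ((X \<omega> ** X \<omega>) $ i $ j))) \<omega> \<le> ennreal m"
  shows "(\<integral>\<^sup>+\<omega>. ennreal (retr (mat_exp (H \<omega> + \<theta> *\<^sub>R X \<omega> - g *\<^sub>R V \<omega>))) * indicator C \<omega> \<partial>M)
    \<le> ennreal (exp (4 * e)) * (\<integral>\<^sup>+\<omega>. ennreal (retr (mat_exp (H \<omega>))) * indicator C \<omega> \<partial>M)"
proof -
  have CM [measurable]: "C \<in> sets M" using C subalg by (auto simp: subalgebra_def)
  have CS: "\<omega> \<in> C \<Longrightarrow> \<omega> \<in> space M" for \<omega> using sets.sets_into_space[OF CM] by blast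
  note [measurable] = measurable_subalg[OF H_meas] measurable_subalg[OF V_meas]
  define K1 where "K1 = herm_part (K0 + e *\<^sub>R mat 1)"
  define G1 where "G1 = herm_part (G0 + e *\<^sub>R mat 1)"
  have sa: "self_adjoint K1" "self_adjoint G1" by (simp_all add: K1_def G1_def)
  obtain N where N: "self_adjoint N" "retr (N ** mat_exp G1) = retr (mat_exp (K1 + G1))"
    "\<And>X. self_adjoint X \<Longrightarrow> retr (mat_exp (K1 + X)) \<le> retr (N ** mat_exp X)"
    "\<And>P Q. self_adjoint P \<Longrightarrow> self_adjoint Q \<Longrightarrow> (\<And>v. qform P v \<le> qform Q v) \<Longrightarrow> retr (N ** P) \<le> retr (N ** Q)"
    using Lieb_supporting_functional[OF sa] by blast
  define c where "c = retr (mat_exp (K1 + G1))"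
  define u where "u \<omega> = retr N + \<theta> * retr (N ** X \<omega>) + g * retr (N ** (X \<omega> ** X \<omega>))" for \<omega>
  have expand: "retr (N ** (mat 1 + s *\<^sub>R A + t *\<^sub>R B)) = retr N + s * retr (N ** A) + t * retr (N ** B)" for s t A B
    by (simp add: matrix_add_ldistrib retr_add mult_scaleR_mat retr_scaleR)
  have upper: "retr (mat_exp (H \<omega> + \<theta> *\<^sub>R X \<omega> - g *\<^sub>R V \<omega>)) \<le> u \<omega>"
    if \<omega>: "\<omega> \<in> C" "lambda_max (X \<omega>) \<le> R" for \<omega>
  proof -
    have X: "self_adjoint (X \<omega>)" and H: "self_adjoint (H \<omega>)"
      using X_self_adjoint H_self_adjoint CS \<omega> by auto
    have "retr (mat_exp (H \<omega> + \<theta> *\<^sub>R X \<omega> - g *\<^sub>R V \<omega>)) \<le> retr (mat_exp (K1 + \<theta> *\<^sub>R X \<omega>))"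
    proof (rule retr_mat_exp_mono)
      fix v
      show "qform (H \<omega> + \<theta> *\<^sub>R X \<omega> - g *\<^sub>R V \<omega>) v \<le> qform (K1 + \<theta> *\<^sub>R X \<omega>) v"
        using qform_le_add_dist[OF K[OF \<omega>(1)], of v]
        by (simp add: K1_def qform_herm_part qform_diff_mat qform_add_mat)
    qed (intro self_adjoint_add self_adjoint_diff self_adjoint_scaleR X H sa V_self_adjoint)+
    also have "\<dots> \<le> retr (N ** mat_exp (\<theta> *\<^sub>R X \<omega>))"
      by (intro N self_adjoint_scaleR X)
    also have "\<dots> \<le> retr (N ** (mat 1 + \<theta> *\<^sub>R X \<omega> + g *\<^sub>R (X \<omega> ** X \<omega>)))"
      unfolding g_def
      by (intro N qform_mat_exp_le_quadratic X R_nonneg \<theta>_nonneg \<theta>_less \<omega> self_adjoint_mat_exp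
          self_adjoint_add self_adjoint_scaleR self_adjoint_square self_adjoint_mat_1)
    finally show ?thesis by (simp add: expand u_def)
  qed
  \<comment> \<open>The left side stands for the conditional expectation of \<open>u\<close>, the
    linear term being centred. It is bounded through
    \<open>1 + g V \<le> 1 + G1 \<le> exp G1\<close>, where the functional is exact.\<close>
  have lower: "retr N + g * retr (N ** mat_cond_exp M F (\<lambda>\<omega>. X \<omega> ** X \<omega>) \<omega>) \<le> c" if \<omega>: "\<omega> \<in> C" for \<omega>
  proof -
    have "retr (N ** mat_cond_exp M F (\<lambda>\<omega>. X \<omega> ** X \<omega>) \<omega>) = retr (N ** V \<omega>)"
      by (simp add: V_def retr_mult_herm_part[OF N(1)])
    \<comment> \<open>The zero middle term brings the expression into the shape of
      \<open>expand\<close>.\<close>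
    moreover have "retr N + 0 * retr (N ** 0) + g * retr (N ** V \<omega>) \<le> retr (N ** mat_exp G1)"
      unfolding expand[symmetric]
    proof (rule N(4))
      fix v
      have "qform (mat 1 + 0 *\<^sub>R 0 + g *\<^sub>R V \<omega>) v \<le> qform (mat 1 + G1) v"
        using qform_le_add_dist[OF G[OF \<omega>], of v]
        by (simp add: G1_def qform_herm_part qform_add_mat)
      also have "\<dots> \<le> qform (mat_exp G1) v" by (intro qform_one_add_le_mat_exp sa)
      finally show "qform (mat 1 + 0 *\<^sub>R 0 + g *\<^sub>R V \<omega>) v \<le> qform (mat_exp G1) v" .
    qed (intro self_adjoint_add self_adjoint_scaleR self_adjoint_mat_1 self_adjoint_0 V_self_adjoint
        self_adjoint_mat_exp sa)+
    ultimately show ?thesis by (simp add: N(2) c_def)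
  qed
  have c_le: "c \<le> exp (4 * e) * retr (mat_exp (H \<omega>))" if \<omega>: "\<omega> \<in> C" for \<omega>
  proof -
    have H: "self_adjoint (H \<omega>)" using H_self_adjoint CS \<omega> by auto
    have "c \<le> retr (mat_exp (H \<omega> + (4 * e) *\<^sub>R mat 1))"
      unfolding c_def
    proof (rule retr_mat_exp_mono)
      fix v
      have "qform K0 v \<le> qform (H \<omega> - g *\<^sub>R V \<omega> + e *\<^sub>R mat 1) v"
        "qform G0 v \<le> qform (g *\<^sub>R V \<omega> + e *\<^sub>R mat 1) v"
        by (intro qform_le_add_dist; use K[OF \<omega>] G[OF \<omega>] in \<open>simp add: dist_commute\<close>)+
      thus "qform (K1 + G1) v \<le> qform (H \<omega> + (4 * e) *\<^sub>R mat 1) v"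
        by (simp add: K1_def G1_def qform_herm_part qform_diff_mat qform_add_mat qform_scaleR_mat)
    qed (intro self_adjoint_add self_adjoint_scaleR self_adjoint_mat_1 sa H)+
    thus ?thesis by (simp add: retr_mat_exp_add_scalar[OF H])
  qed
  have X2 [measurable]: "(\<lambda>\<omega>. X \<omega> ** X \<omega>) \<in> borel_measurable M" by measurable
  note sq = integral_retr_mult_cond_exp[OF X2 C bound, of N]
  have lin: "integrable M (\<lambda>\<omega>. indicator C \<omega> * retr (N ** X \<omega>))"
    "(\<integral>\<omega>. indicator C \<omega> * retr (N ** X \<omega>) \<partial>M) = 0"
    using integrable_retr_mult[OF X_integrable[OF C], of N] by (simp_all add: X_centered[OF C])
  have const: "integrable M (\<lambda>\<omega>. indicator C \<omega> * a)" for a :: real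
    by (simp add: less_top[symmetric])
  have u_eq: "indicator C \<omega> * u \<omega> = indicator C \<omega> * retr N + \<theta> * (indicator C \<omega> * retr (N ** X \<omega>))
      + g * (indicator C \<omega> * retr (N ** (X \<omega> ** X \<omega>)))" for \<omega>
    by (simp add: u_def algebra_simps)
  have u_int: "integrable M (\<lambda>\<omega>. indicator C \<omega> * u \<omega>)"
    unfolding u_eq using lin sq const by simp
  have "(\<integral>\<omega>. indicator C \<omega> * u \<omega> \<partial>M)
      = (\<integral>\<omega>. indicator C \<omega> * retr N + g * (indicator C \<omega> * retr (N ** mat_cond_exp M F (\<lambda>\<omega>. X \<omega> ** X \<omega>) \<omega>)) \<partial>M)"
    unfolding u_eq using lin sq const by simp
  also have "\<dots> \<le> (\<integral>\<omega>. indicator C \<omega> * c \<partial>M)"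
    using lower sq const by (intro integral_mono) (auto simp: indicator_def)
  finally have int_le: "(\<integral>\<omega>. indicator C \<omega> * u \<omega> \<partial>M) \<le> (\<integral>\<omega>. indicator C \<omega> * c \<partial>M)" .
  have c_nonneg: "0 \<le> c" unfolding c_def by (intro retr_mat_exp_nonneg self_adjoint_add sa)
  \<comment> \<open>\<open>u\<close> dominates a trace of an exponential; its sign permits the
    passage from the nonnegative integral to the Bochner integral.\<close>
  have nonneg: "AE \<omega> in M. 0 \<le> indicator C \<omega> * u \<omega>"
    using X_le
  proof eventually_elim
    case (elim \<omega>)
    show ?case
    proof (cases "\<omega> \<in> C")
      case True
      have "0 \<le> retr (mat_exp (H \<omega> + \<theta> *\<^sub>R X \<omega> - g *\<^sub>R V \<omega>))"
        using CS[OF True] by (intro retr_mat_exp_nonneg self_adjoint_add self_adjoint_diff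
            self_adjoint_scaleR X_self_adjoint H_self_adjoint V_self_adjoint)
      with upper[OF True elim] True show ?thesis by simp
    qed simp
  qed
  have "(\<integral>\<^sup>+\<omega>. ennreal (retr (mat_exp (H \<omega> + \<theta> *\<^sub>R X \<omega> - g *\<^sub>R V \<omega>))) * indicator C \<omega> \<partial>M)
      \<le> (\<integral>\<^sup>+\<omega>. ennreal (indicator C \<omega> * u \<omega>) \<partial>M)"
    using X_le by (intro nn_integral_mono_AE, eventually_elim) (auto simp: indicator_def intro!: ennreal_leI upper)
  also have "\<dots> = ennreal (\<integral>\<omega>. indicator C \<omega> * u \<omega> \<partial>M)"
    by (rule nn_integral_eq_integral[OF u_int nonneg])
  also have "\<dots> \<le> ennreal (\<integral>\<omega>. indicator C \<omega> * c \<partial>M)"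
    by (rule ennreal_leI[OF int_le])
  also have "\<dots> = (\<integral>\<^sup>+\<omega>. ennreal (indicator C \<omega> * c) \<partial>M)"
    using c_nonneg by (intro nn_integral_eq_integral[symmetric] const) auto
  also have "\<dots> \<le> (\<integral>\<^sup>+\<omega>. ennreal (exp (4 * e)) * (ennreal (retr (mat_exp (H \<omega>))) * indicator C \<omega>) \<partial>M)"
    by (intro nn_integral_mono) (auto simp: indicator_def c_le ennreal_leI simp flip: ennreal_mult')
  also have "\<dots> = ennreal (exp (4 * e)) * (\<integral>\<^sup>+\<omega>. ennreal (retr (mat_exp (H \<omega>))) * indicator C \<omega> \<partial>M)"
    by (rule nn_integral_cmult) measurable
  finally show ?thesis .
qed

text \<open>Centres from a countable dense set and integer bounds on the conditional second moments
  give countably many cells. Made disjoint, they cover \<open>D\<close> up to a null set, and the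
  estimate on one cell is summed.\<close>

lemma step_approx:
  assumes D: "D \<in> sets F" and e: "e > 0"
  shows "(\<integral>\<^sup>+\<omega>. ennreal (retr (mat_exp (H \<omega> + \<theta> *\<^sub>R X \<omega> - g *\<^sub>R V \<omega>))) * indicator D \<omega> \<partial>M)
    \<le> ennreal (exp (4 * e)) * (\<integral>\<^sup>+\<omega>. ennreal (retr (mat_exp (H \<omega>))) * indicator D \<omega> \<partial>M)"
proof -
  have space_F: "space F = space M" and sets_F: "sets F \<subseteq> sets M"
    using subalg by (auto simp: subalgebra_def)
  have DM [measurable]: "D \<in> sets M" using D sets_F by auto
  note [measurable] = measurable_subalg[OF H_meas] measurable_subalg[OF V_meas]
  define f where "f \<omega> = ennreal (retr (mat_exp (H \<omega> + \<theta> *\<^sub>R X \<omega> - g *\<^sub>R V \<omega>)))" for \<omega>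
  define h where "h \<omega> = ennreal (retr (mat_exp (H \<omega>)))" for \<omega>
  have [measurable]: "f \<in> borel_measurable M" "h \<in> borel_measurable M"
    unfolding f_def[abs_def] h_def[abs_def] by measurable
  define q where "q i j = nn_cond_exp M F (\<lambda>\<omega>. ennreal (cmod ((X \<omega> ** X \<omega>) $ i $ j)))" for i j
  obtain B :: "(complex ^ 'n ^ 'n) set" where B: "countable B" "\<And>U. open U \<Longrightarrow> U \<noteq> {} \<Longrightarrow> \<exists>b\<in>B. b \<in> U"
    using countable_dense_setE by blast
  hence "B \<noteq> {}" by (metis UNIV_not_empty empty_iff open_UNIV)
  define S where "S = B \<times> B \<times> (UNIV :: nat set)"
  have S: "countable S" "S \<noteq> {}" using B \<open>B \<noteq> {}\<close> by (auto simp: S_def)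
  define E where "E = (\<lambda>(a, b, n). {\<omega> \<in> space F. dist (H \<omega> - g *\<^sub>R V \<omega>) a \<le> e \<and> dist (g *\<^sub>R V \<omega>) b \<le> e
      \<and> (\<forall>i j. q i j \<omega> \<le> of_nat n)})"
  have E_meas: "E s \<in> sets F" for s
  proof -
    obtain a b n where s: "s = (a, b, n)" by (cases s)
    show ?thesis unfolding E_def s prod.case q_def by measurable
  qed
  define Q where "Q = disjointed (\<lambda>k. E (from_nat_into S k))"
  have "range (\<lambda>k. E (from_nat_into S k)) \<subseteq> sets F" using E_meas by blast
  hence Q_meas: "Q k \<in> sets F" for k
    unfolding Q_def using sets.range_disjointed_sets by blast
  define P where "P k = D \<inter> Q k" for k
  have P_meas: "P k \<in> sets F" for k using D Q_meas by (auto simp: P_def)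
  have P_meas' [measurable]: "P k \<in> sets M" for k using P_meas sets_F by auto
  have P_disj: "disjoint_family P"
    using disjoint_family_disjointed[of "\<lambda>k. E (from_nat_into S k)"]
    by (auto simp: disjoint_family_on_def P_def Q_def)
  have AE_q: "AE \<omega> in M. \<forall>i j. q i j \<omega> < \<infinity>"
    using X2_exists unfolding mat_cond_exp_exists_def q_def AE_all_countable .
  have cover: "\<omega> \<in> D \<longleftrightarrow> \<omega> \<in> (\<Union>k. P k)" if "\<omega> \<in> space M" "\<forall>i j. q i j \<omega> < \<infinity>" for \<omega>
  proof -
    obtain a where a: "a \<in> B" "a \<in> ball (H \<omega> - g *\<^sub>R V \<omega>) e"
      using B(2)[of "ball (H \<omega> - g *\<^sub>R V \<omega>) e"] e by auto
    obtain b where b: "b \<in> B" "b \<in> ball (g *\<^sub>R V \<omega>) e"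
      using B(2)[of "ball (g *\<^sub>R V \<omega>) e"] e by auto
    \<comment> \<open>Bounding the finite sum of all entries yields a single \<open>n\<close> valid
      for each of them.\<close>
    have "(\<Sum>i\<in>UNIV. \<Sum>j\<in>UNIV. q i j \<omega>) < \<infinity>" using that(2) by simp
    then obtain n where n: "(\<Sum>i\<in>UNIV. \<Sum>j\<in>UNIV. q i j \<omega>) \<le> of_nat n"
      by (metis ennreal_Ex_less_of_nat infinity_ennreal_def less_imp_le)
    have "q i j \<omega> \<le> of_nat n" for i j
    proof -
      have "q i j \<omega> \<le> (\<Sum>j\<in>UNIV. q i j \<omega>)" by (rule member_le_sum) auto
      also have "\<dots> \<le> (\<Sum>i\<in>UNIV. \<Sum>j\<in>UNIV. q i j \<omega>)"
        by (rule member_le_sum[of i UNIV "\<lambda>i. \<Sum>j\<in>UNIV. q i j \<omega>"]) auto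
      finally show ?thesis using n by simp
    qed
    hence "\<omega> \<in> E (a, b, n)" using a b that space_F by (auto simp: E_def less_imp_le)
    moreover have "(a, b, n) \<in> S" using a b by (simp add: S_def)
    ultimately have "\<omega> \<in> (\<Union>k. E (from_nat_into S k))"
      using from_nat_into_surj[OF S(1)] by (metis UN_iff UNIV_I)
    hence "\<omega> \<in> (\<Union>k. Q k)" unfolding Q_def UN_disjointed_eq .
    thus ?thesis by (auto simp: P_def)
  qed
  have split: "(\<integral>\<^sup>+\<omega>. w \<omega> * indicator D \<omega> \<partial>M) = (\<Sum>k. \<integral>\<^sup>+\<omega>. w \<omega> * indicator (P k) \<omega> \<partial>M)"
    if [measurable]: "w \<in> borel_measurable M" for w :: "'a \<Rightarrow> ennreal"
  proof -
    have "(\<integral>\<^sup>+\<omega>. w \<omega> * indicator D \<omega> \<partial>M) = (\<integral>\<^sup>+\<omega>. w \<omega> * indicator (\<Union>k. P k) \<omega> \<partial>M)"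
      using AE_q AE_space
      by (intro nn_integral_cong_AE, eventually_elim) (simp add: indicator_def cover)
    also have "\<dots> = (\<Sum>k. \<integral>\<^sup>+\<omega>. w \<omega> * indicator (P k) \<omega> \<partial>M)"
      by (rule nn_integral_disjoint_family[OF _ _ P_disj]) measurable
    finally show ?thesis .
  qed
  have cell: "(\<integral>\<^sup>+\<omega>. f \<omega> * indicator (P k) \<omega> \<partial>M) \<le> ennreal (exp (4 * e)) * (\<integral>\<^sup>+\<omega>. h \<omega> * indicator (P k) \<omega> \<partial>M)" for k
  proof -
    obtain a b n where s: "from_nat_into S k = (a, b, n)" by (cases "from_nat_into S k")
    have sub: "P k \<subseteq> E (a, b, n)"
      using disjointed_subset[of "\<lambda>k. E (from_nat_into S k)" k] by (auto simp: P_def Q_def s)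
    show ?thesis unfolding f_def h_def
    proof (rule step_on_cell[OF P_meas, where m = "real n"])
      fix \<omega> i j assume "\<omega> \<in> P k"
      thus "nn_cond_exp M F (\<lambda>\<omega>. ennreal (cmod ((X \<omega> ** X \<omega>) $ i $ j))) \<omega> \<le> ennreal (real n)"
        using sub by (auto simp: E_def q_def ennreal_of_nat_eq_real_of_nat)
    qed (use sub in \<open>auto simp: E_def\<close>)
  qed
  have "(\<integral>\<^sup>+\<omega>. f \<omega> * indicator D \<omega> \<partial>M) = (\<Sum>k. \<integral>\<^sup>+\<omega>. f \<omega> * indicator (P k) \<omega> \<partial>M)"
    by (rule split) measurable
  also have "\<dots> \<le> (\<Sum>k. ennreal (exp (4 * e)) * (\<integral>\<^sup>+\<omega>. h \<omega> * indicator (P k) \<omega> \<partial>M))"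
    by (intro suminf_le cell) auto
  also have "\<dots> = ennreal (exp (4 * e)) * (\<Sum>k. \<integral>\<^sup>+\<omega>. h \<omega> * indicator (P k) \<omega> \<partial>M)"
    by (rule ennreal_suminf_cmult)
  also have "(\<Sum>k. \<integral>\<^sup>+\<omega>. h \<omega> * indicator (P k) \<omega> \<partial>M) = (\<integral>\<^sup>+\<omega>. h \<omega> * indicator D \<omega> \<partial>M)"
    by (rule split[symmetric]) measurable
  finally show ?thesis by (simp add: f_def h_def)
qed

text \<open>The factor \<open>exp (4 * e)\<close> is the only trace of the partition, and it tends
  to 1 as \<open>e\<close> decreases to 0.\<close>

lemma step:
  assumes D: "D \<in> sets F"
  shows "(\<integral>\<^sup>+\<omega>. ennreal (retr (mat_exp (H \<omega> + \<theta> *\<^sub>R X \<omega> - g *\<^sub>R V \<omega>))) * indicator D \<omega> \<partial>M)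
    \<le> (\<integral>\<^sup>+\<omega>. ennreal (retr (mat_exp (H \<omega>))) * indicator D \<omega> \<partial>M)" (is "?l \<le> ?r")
proof (rule tendsto_lowerbound)
  have "((\<lambda>e. ennreal (exp (4 * e)) * ?r) \<longlongrightarrow> ennreal (exp (4 * 0)) * ?r) (at_right 0)"
    by (intro tendsto_mult_ennreal tendsto_const tendsto_ennrealI tendsto_intros) auto
  thus "((\<lambda>e. ennreal (exp (4 * e)) * ?r) \<longlongrightarrow> ?r) (at_right 0)" by simp
  show "\<forall>\<^sub>F e in at_right 0. ?l \<le> ennreal (exp (4 * e)) * ?r"
    using eventually_at_right_less[of "0::real"] by eventually_elim (rule step_approx[OF D])
qed simp

end

section \<open>The maximal inequality and Freedman's inequality\<close>

text \<open>Ville's inequality, by induction on a finite horizon instead of optional stopping; the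
  horizon then tends to infinity by continuity of the measure from below.\<close>

lemma supermartingale_maximal_inequality:
  fixes S :: "nat \<Rightarrow> 'a \<Rightarrow> ennreal"
  assumes filt: "filtration (space M) F" and sub: "\<And>k. subalgebra M (F k)"
    and meas: "\<And>k. S k \<in> borel_measurable (F k)"
    and step: "\<And>k D. D \<in> sets (F k) \<Longrightarrow>
      (\<integral>\<^sup>+\<omega>. S (Suc k) \<omega> * indicator D \<omega> \<partial>M) \<le> (\<integral>\<^sup>+\<omega>. S k \<omega> * indicator D \<omega> \<partial>M)"
  shows "l * emeasure M {\<omega> \<in> space M. \<exists>k. l \<le> S k \<omega>} \<le> (\<integral>\<^sup>+\<omega>. S 0 \<omega> \<partial>M)"
proof -
  have space_F: "space (F k) = space M" and sets_F: "sets (F k) \<subseteq> sets M" for k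
    using sub[of k] by (auto simp: subalgebra_def)
  have mono_F: "sets (F i) \<subseteq> sets (F j)" if "i \<le> j" for i j
    using filtration.sets_F_mono[OF filt that] .
  have [measurable]: "S k \<in> borel_measurable M" for k
    using measurable_from_subalg[OF sub meas] .
  define A where "A n = {\<omega> \<in> space M. \<exists>k\<le>n. l \<le> S k \<omega>}" for n
  have hit: "{\<omega> \<in> space M. l \<le> S k \<omega>} \<in> sets (F k)" for k
    using borel_measurable_const[of l] meas[of k] unfolding space_F[of k, symmetric] by measurable
  have A_sets: "A n \<in> sets (F n)" for n
  proof -
    have "A n = (\<Union>k\<in>{..n}. {\<omega> \<in> space M. l \<le> S k \<omega>})" by (auto simp: A_def)
    also have "\<dots> \<in> sets (F n)" using hit mono_F by (intro sets.finite_UN) auto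
    finally show ?thesis .
  qed
  have [measurable]: "A n \<in> sets M" for n using A_sets sets_F by blast
  define B where "B n = space M - A n" for n
  have B_sets: "B n \<in> sets (F n)" for n
    using sets.compl_sets[OF A_sets[of n]] by (simp add: B_def space_F)
  have [measurable]: "B n \<in> sets M" for n using B_sets sets_F by blast
  have split: "l * emeasure M D' + (\<integral>\<^sup>+\<omega>. S n \<omega> * indicator D'' \<omega> \<partial>M) \<le> (\<integral>\<^sup>+\<omega>. S n \<omega> * indicator (D' \<union> D'') \<omega> \<partial>M)"
    if [measurable]: "D' \<in> sets M" "D'' \<in> sets M" and D: "D' \<inter> D'' = {}" "\<And>\<omega>. \<omega> \<in> D' \<Longrightarrow> l \<le> S n \<omega>" for n D' D''
  proof -
    have "l * emeasure M D' + (\<integral>\<^sup>+\<omega>. S n \<omega> * indicator D'' \<omega> \<partial>M)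
        = (\<integral>\<^sup>+\<omega>. l * indicator D' \<omega> + S n \<omega> * indicator D'' \<omega> \<partial>M)"
      by (simp add: nn_integral_add nn_integral_cmult_indicator)
    also have "\<dots> \<le> (\<integral>\<^sup>+\<omega>. S n \<omega> * indicator (D' \<union> D'') \<omega> \<partial>M)"
      using D by (intro nn_integral_mono) (auto simp: indicator_def)
    finally show ?thesis .
  qed
  \<comment> \<open>The left side is the integral of the process stopped on reaching
    \<open>l\<close>, with its value counted as \<open>l\<close> from then on.\<close>
  have main: "l * emeasure M (A n) + (\<integral>\<^sup>+\<omega>. S n \<omega> * indicator (B n) \<omega> \<partial>M) \<le> (\<integral>\<^sup>+\<omega>. S 0 \<omega> \<partial>M)" for n
  proof (induction n)
    case 0
    have "l * emeasure M (A 0) + (\<integral>\<^sup>+\<omega>. S 0 \<omega> * indicator (B 0) \<omega> \<partial>M)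
        \<le> (\<integral>\<^sup>+\<omega>. S 0 \<omega> * indicator (A 0 \<union> B 0) \<omega> \<partial>M)"
      by (rule split) (auto simp: A_def B_def)
    also have "\<dots> \<le> (\<integral>\<^sup>+\<omega>. S 0 \<omega> \<partial>M)" by (intro nn_integral_mono) (auto simp: indicator_def)
    finally show ?case .
  next
    case (Suc n)
    \<comment> \<open>The points that reach \<open>l\<close> for the first time at
      \<open>Suc n\<close>.\<close>
    define D where "D = A (Suc n) - A n"
    have [measurable]: "D \<in> sets M" by (simp add: D_def)
    have AD: "A (Suc n) = A n \<union> D" "A n \<inter> D = {}" and BD: "B n = D \<union> B (Suc n)" "D \<inter> B (Suc n) = {}"
      by (auto simp: D_def A_def B_def le_Suc_eq)
    have "l * emeasure M (A (Suc n)) + (\<integral>\<^sup>+\<omega>. S (Suc n) \<omega> * indicator (B (Suc n)) \<omega> \<partial>M)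
        = l * emeasure M (A n) + (l * emeasure M D + (\<integral>\<^sup>+\<omega>. S (Suc n) \<omega> * indicator (B (Suc n)) \<omega> \<partial>M))"
      by (simp add: AD plus_emeasure[symmetric] distrib_left add.assoc)
    also have "l * emeasure M D + (\<integral>\<^sup>+\<omega>. S (Suc n) \<omega> * indicator (B (Suc n)) \<omega> \<partial>M)
        \<le> (\<integral>\<^sup>+\<omega>. S (Suc n) \<omega> * indicator (B n) \<omega> \<partial>M)"
      unfolding BD(1) by (rule split) (use BD in \<open>auto simp: D_def A_def le_Suc_eq\<close>)
    also have "\<dots> \<le> (\<integral>\<^sup>+\<omega>. S n \<omega> * indicator (B n) \<omega> \<partial>M)" by (rule step[OF B_sets])
    also note Suc.IH
    finally show ?case by (simp add: add_left_mono)
  qed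
  have "incseq A" by (auto simp: incseq_def A_def intro: order_trans)
  hence "emeasure M (\<Union>n. A n) = (SUP n. emeasure M (A n))"
    by (intro SUP_emeasure_incseq[symmetric]) auto
  also have "(\<Union>n. A n) = {\<omega> \<in> space M. \<exists>k. l \<le> S k \<omega>}" by (auto simp: A_def)
  finally have "l * emeasure M {\<omega> \<in> space M. \<exists>k. l \<le> S k \<omega>} = (SUP n. l * emeasure M (A n))"
    by (simp add: SUP_mult_left_ennreal)
  also have "\<dots> \<le> (\<integral>\<^sup>+\<omega>. S 0 \<omega> \<partial>M)"
  proof (rule SUP_least)
    fix n
    have "l * emeasure M (A n) \<le> l * emeasure M (A n) + (\<integral>\<^sup>+\<omega>. S n \<omega> * indicator (B n) \<omega> \<partial>M)" by simp
    also note main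
    finally show "l * emeasure M (A n) \<le> (\<integral>\<^sup>+\<omega>. S 0 \<omega> \<partial>M)" .
  qed
  finally show ?thesis .
qed

text \<open>The martingale identity, integrated over a set of \<open>F k\<close>, says that
  consecutive values have equal integrals there, real and imaginary parts separately.\<close>

lemma martingale_difference_centered:
  fixes Y :: "nat \<Rightarrow> 'a \<Rightarrow> complex ^ 'n ^ 'n"
  assumes P: "prob_space M" and sub: "\<And>k. subalgebra M (F k)" and mart: "matrix_martingale M F Y"
    and Y0: "\<And>\<omega>. \<omega> \<in> space M \<Longrightarrow> Y 0 \<omega> = 0" and C: "C \<in> sets (F k)"
  shows "integrable M (\<lambda>\<omega>. indicator C \<omega> * Re (difference_seq Y (Suc k) \<omega> $ i $ j))"
    "integrable M (\<lambda>\<omega>. indicator C \<omega> * Im (difference_seq Y (Suc k) \<omega> $ i $ j))"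
    "(\<integral>\<omega>. indicator C \<omega> * Re (difference_seq Y (Suc k) \<omega> $ i $ j) \<partial>M) = 0"
    "(\<integral>\<omega>. indicator C \<omega> * Im (difference_seq Y (Suc k) \<omega> $ i $ j) \<partial>M) = 0"
proof -
  interpret prob_space M by fact
  interpret finite_measure_subalgebra M "F k"
    by unfold_locales (rule sub)
  have CM [measurable]: "C \<in> sets M" using C subalg by (auto simp: subalgebra_def)
  have ind: "indicator C \<in> borel_measurable (F k)" using C by measurable
  have [measurable]: "Y n \<in> borel_measurable M" for n
    using mart measurable_from_subalg[OF sub] by (auto simp: matrix_martingale_def)
  have int: "integrable M (\<lambda>\<omega>. Y n \<omega> $ i $ j)" for n
  proof (cases n)
    \<comment> \<open>\<open>matrix_martingale\<close> asserts integrability from time 1 on; at time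
      0 it comes from the initial value 0.\<close>
    case 0
    have "integrable M (\<lambda>\<omega>. Y n \<omega> $ i $ j) \<longleftrightarrow> integrable M (\<lambda>\<omega>. 0 :: complex)"
      by (rule Bochner_Integration.integrable_cong[OF refl]) (simp add: 0 Y0)
    thus ?thesis by simp
  next
    case (Suc m)
    have "integrable M (\<lambda>\<omega>. spectral_norm (Y n \<omega>))"
      using mart Suc by (auto simp: matrix_martingale_def)
    thus ?thesis
    proof (rule Bochner_Integration.integrable_bound)
      show "AE \<omega> in M. norm (Y n \<omega> $ i $ j) \<le> norm (spectral_norm (Y n \<omega>))"
        by (intro AE_I2 order_trans[OF cmod_le_spectral_norm]) simp
    qed measurable
  qed
  have intC: "integrable M (\<lambda>\<omega>. indicator C \<omega> * Re (Y n \<omega> $ i $ j))"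
    "integrable M (\<lambda>\<omega>. indicator C \<omega> * Im (Y n \<omega> $ i $ j))" for n
    using integrable_mult_indicator[OF CM integrable_Re[OF int[of n]]]
      integrable_mult_indicator[OF CM integrable_Im[OF int[of n]]] by simp_all
  have AE: "AE \<omega> in M. mat_cond_exp M (F k) (Y (Suc k)) \<omega> = Y k \<omega>"
    using mart unfolding matrix_martingale_def by (metis One_nat_def diff_Suc_1 le_add1 plus_1_eq_Suc)
  have eq_Re: "(\<integral>\<omega>. indicator C \<omega> * Re (Y (Suc k) \<omega> $ i $ j) \<partial>M) = (\<integral>\<omega>. indicator C \<omega> * Re (Y k \<omega> $ i $ j) \<partial>M)"
  proof -
    have "(\<integral>\<omega>. indicator C \<omega> * Re (Y (Suc k) \<omega> $ i $ j) \<partial>M)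
        = (\<integral>\<omega>. indicator C \<omega> * real_cond_exp M (F k) (\<lambda>\<omega>. Re (Y (Suc k) \<omega> $ i $ j)) \<omega> \<partial>M)"
      by (rule real_cond_exp_intg(2)[symmetric, OF intC(1) ind]) measurable
    also have "\<dots> = (\<integral>\<omega>. indicator C \<omega> * Re (Y k \<omega> $ i $ j) \<partial>M)"
    proof -
      have "AE \<omega> in M. indicator C \<omega> * real_cond_exp M (F k) (\<lambda>\<omega>. Re (Y (Suc k) \<omega> $ i $ j)) \<omega>
          = indicator C \<omega> * Re (Y k \<omega> $ i $ j)"
        using AE by eventually_elim (simp flip: mat_cond_exp_entries)
      thus ?thesis by (rule integral_cong_AE[rotated 2]) measurable
    qed
    finally show ?thesis .
  qed
  have eq_Im: "(\<integral>\<omega>. indicator C \<omega> * Im (Y (Suc k) \<omega> $ i $ j) \<partial>M) = (\<integral>\<omega>. indicator C \<omega> * Im (Y k \<omega> $ i $ j) \<partial>M)"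
  proof -
    have "(\<integral>\<omega>. indicator C \<omega> * Im (Y (Suc k) \<omega> $ i $ j) \<partial>M)
        = (\<integral>\<omega>. indicator C \<omega> * real_cond_exp M (F k) (\<lambda>\<omega>. Im (Y (Suc k) \<omega> $ i $ j)) \<omega> \<partial>M)"
      by (rule real_cond_exp_intg(2)[symmetric, OF intC(2) ind]) measurable
    also have "\<dots> = (\<integral>\<omega>. indicator C \<omega> * Im (Y k \<omega> $ i $ j) \<partial>M)"
    proof -
      have "AE \<omega> in M. indicator C \<omega> * real_cond_exp M (F k) (\<lambda>\<omega>. Im (Y (Suc k) \<omega> $ i $ j)) \<omega>
          = indicator C \<omega> * Im (Y k \<omega> $ i $ j)"
        using AE by eventually_elim (simp flip: mat_cond_exp_entries)
      thus ?thesis by (rule integral_cong_AE[rotated 2]) measurable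
    qed
    finally show ?thesis .
  qed
  have diff: "indicator C \<omega> * Re (difference_seq Y (Suc k) \<omega> $ i $ j)
      = indicator C \<omega> * Re (Y (Suc k) \<omega> $ i $ j) - indicator C \<omega> * Re (Y k \<omega> $ i $ j)"
    "indicator C \<omega> * Im (difference_seq Y (Suc k) \<omega> $ i $ j)
      = indicator C \<omega> * Im (Y (Suc k) \<omega> $ i $ j) - indicator C \<omega> * Im (Y k \<omega> $ i $ j)" for \<omega>
    by (simp_all add: difference_seq_def right_diff_distrib)
  show "integrable M (\<lambda>\<omega>. indicator C \<omega> * Re (difference_seq Y (Suc k) \<omega> $ i $ j))"
    "integrable M (\<lambda>\<omega>. indicator C \<omega> * Im (difference_seq Y (Suc k) \<omega> $ i $ j))"
    "(\<integral>\<omega>. indicator C \<omega> * Re (difference_seq Y (Suc k) \<omega> $ i $ j) \<partial>M) = 0"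
    "(\<integral>\<omega>. indicator C \<omega> * Im (difference_seq Y (Suc k) \<omega> $ i $ j) \<partial>M) = 0"
    unfolding diff using intC eq_Re eq_Im by simp_all
qed

section \<open>The tail bound for matrix martingales\<close>

theorem theorem1p2:
  fixes M :: "'a measure"
    and F :: "nat \<Rightarrow> 'a measure"
    and Y :: "nat \<Rightarrow> 'a \<Rightarrow> complex ^ 'n ^ 'n"
    and R t \<sigma> :: real
  assumes "prob_space M"
    and "filtration (space M) F"
    and "\<And>k. subalgebra M (F k)"
    and "matrix_martingale M F Y"
    and "\<And>k \<omega>. \<omega> \<in> space M \<Longrightarrow> self_adjoint (Y k \<omega>)"
    and "\<And>\<omega>. \<omega> \<in> space M \<Longrightarrow> Y 0 \<omega> = 0"
    and "\<And>k. k \<ge> 1 \<Longrightarrow> AE \<omega> in M. lambda_max (difference_seq Y k \<omega>) \<le> R"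
    and "\<And>j. j \<ge> 1 \<Longrightarrow> mat_cond_exp_exists M (F (j - 1))
           (\<lambda>\<omega>. difference_seq Y j \<omega> ** difference_seq Y j \<omega>)"
    and "t \<ge> 0"
    and "\<sigma>\<^sup>2 > 0"
  shows "measure M {\<omega> \<in> space M. \<exists>k\<ge>0. lambda_max (Y k \<omega>) \<ge> t \<and>
             spectral_norm (predictable_quad_var M F Y k \<omega>) \<le> \<sigma>\<^sup>2}
         \<le> real CARD('n) * exp ((- t\<^sup>2 / 2) / (\<sigma>\<^sup>2 + R * t / 3))"
proof -
  note sub = assms(3) and Y_sa = assms(5) and Y0 = assms(6)
  interpret prob_space M by fact
  \<comment> \<open>Shifted by one: \<open>X k\<close> is the increment from \<open>k\<close> to
    \<open>Suc k\<close>, conditioned on \<open>F k\<close>.\<close>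
  define X where "X k = difference_seq Y (Suc k)" for k
  define W where "W = predictable_quad_var M F Y"
  have X_eq: "X k \<omega> = Y (Suc k) \<omega> - Y k \<omega>" for k \<omega>
    by (simp add: X_def difference_seq_def)
  have X_sa: "self_adjoint (X k \<omega>)" if "\<omega> \<in> space M" for k \<omega>
    unfolding X_eq by (intro self_adjoint_diff Y_sa that)
  have X_le: "AE \<omega> in M. lambda_max (X k \<omega>) \<le> R" for k
    using assms(7)[of "Suc k"] by (simp add: X_def)
  have X_centered: "integrable M (\<lambda>\<omega>. indicator C \<omega> * Re (X k \<omega> $ i $ j))"
    "integrable M (\<lambda>\<omega>. indicator C \<omega> * Im (X k \<omega> $ i $ j))"
    "(\<integral>\<omega>. indicator C \<omega> * Re (X k \<omega> $ i $ j) \<partial>M) = 0"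
    "(\<integral>\<omega>. indicator C \<omega> * Im (X k \<omega> $ i $ j) \<partial>M) = 0"
    if "C \<in> sets (F k)" for C k i j
    unfolding X_def using martingale_difference_centered[OF assms(1) sub assms(4) Y0 that] by simp_all
  have Y_meas: "Y k \<in> borel_measurable (F k)" for k
    using assms(4) by (simp add: matrix_martingale_def)
  have sub_F: "subalgebra (F k) (F j)" if "j \<le> k" for j k
    using filtration.sets_F_mono[OF assms(2) that] sub[of j] sub[of k] by (simp add: subalgebra_def)
  have W_meas: "W k \<in> borel_measurable (F k)" for k
  proof -
    have "mat_cond_exp M (F (j - 1)) f \<in> borel_measurable (F k)" if "j \<in> {1..k}" for j and f :: "'a \<Rightarrow> complex ^ 'n ^ 'n"
      using that by (intro measurable_from_subalg[OF sub_F borel_measurable_mat_cond_exp]) auto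
    thus ?thesis
      unfolding W_def predictable_quad_var_def[abs_def] by (intro borel_measurable_sum) simp
  qed
  \<comment> \<open>The trace of the first increment has mean zero and is almost surely at most
    \<open>R\<close> times the dimension. The sign of \<open>R\<close> makes \<open>s\<close>
    positive and is required by the exponential estimate.\<close>
  have R: "0 \<le> R"
  proof (rule ccontr)
    assume "\<not> 0 \<le> R"
    have C: "space M \<in> sets (F 0)"
      using sets.top[of "F 0"] sub[of 0] by (metis subalgebra_def)
    have int: "integrable M (\<lambda>\<omega>. indicator (space M) \<omega> * retr (mat 1 ** X 0 \<omega>))"
      "(\<integral>\<omega>. indicator (space M) \<omega> * retr (mat 1 ** X 0 \<omega>) \<partial>M) = 0"
      using integrable_retr_mult[OF X_centered(1,2)[OF C], of "mat 1"]
      by (simp_all add: X_centered(3,4)[OF C])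
    have "AE \<omega> in M. indicator (space M) \<omega> * retr (mat 1 ** X 0 \<omega>) \<le> R * CARD('n)"
      using X_le[of 0] AE_space
    proof eventually_elim
      case (elim \<omega>)
      have U: "unitary (mat 1 :: complex ^ 'n ^ 'n)" by (simp add: unitary_def)
      have "retr (X 0 \<omega>) \<le> (\<Sum>k\<in>(UNIV :: 'n set). R)"
        unfolding retr_eq_sum_qform[OF U]
      proof (intro sum_mono)
        fix k :: 'n
        show "qform (X 0 \<omega>) (column k (mat 1)) \<le> R"
          using qform_le_lambda_max[OF X_sa[OF elim(2), of 0], of "column k (mat 1)"] elim(1)
          by (simp add: unitary_column(2)[OF U])
      qed
      thus ?case using elim by (simp add: mult.commute)
    qed
    hence "(\<integral>\<omega>. indicator (space M) \<omega> * retr (mat 1 ** X 0 \<omega>) \<partial>M) \<le> (\<integral>\<omega>. R * CARD('n) \<partial>M)"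
      by (intro integral_mono_AE int) auto
    hence "0 \<le> R * CARD('n)" unfolding int(2) by (simp add: prob_space)
    with \<open>\<not> 0 \<le> R\<close> show False by (simp add: zero_le_mult_iff)
  qed
  define s where "s = \<sigma>\<^sup>2 + R * t / 3"
  \<comment> \<open>With this choice \<open>1 - \<theta> * R / 3\<close> equals
    \<open>\<sigma>\<^sup>2 / s\<close>, so \<open>g * \<sigma>\<^sup>2\<close> is half of
    \<open>\<theta> * t\<close>.\<close>
  define \<theta> where "\<theta> = t / s"
  define g where "g = (\<theta>\<^sup>2 / 2) / (1 - \<theta> * R / 3)"
  have s: "s > 0" using R assms(9,10) by (simp add: s_def add_pos_nonneg)
  have \<theta>: "0 \<le> \<theta>" using s assms(9) by (simp add: \<theta>_def)
  have \<theta>R: "1 - \<theta> * R / 3 = \<sigma>\<^sup>2 / s"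
  proof -
    have "\<sigma>\<^sup>2 / s = (s - R * t / 3) / s" by (simp add: s_def)
    also have "\<dots> = 1 - \<theta> * R / 3" using s by (simp add: \<theta>_def diff_divide_distrib mult.commute)
    finally show ?thesis ..
  qed
  have "0 < \<sigma>\<^sup>2 / s" using s assms(10) by simp
  hence \<theta>_less: "\<theta> * R < 3" using \<theta>R by linarith
  have g: "0 \<le> g" unfolding g_def using \<theta>_less by (intro divide_nonneg_nonneg) auto
  have exponent: "\<theta> * t - g * \<sigma>\<^sup>2 = (t\<^sup>2 / 2) / s"
  proof -
    have "\<sigma> \<noteq> 0" using assms(10) by auto
    thus ?thesis unfolding g_def \<theta>R using s by (simp add: \<theta>_def field_simps power2_eq_square)
  qed
  \<comment> \<open>The Hermitian part of \<open>W\<close> makes \<open>Z\<close> self-adjoint at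
    every point and has the same quadratic form as \<open>W\<close>.\<close>
  define Z where "Z k \<omega> = \<theta> *\<^sub>R Y k \<omega> - g *\<^sub>R herm_part (W k \<omega>)" for k \<omega>
  define S where "S k \<omega> = ennreal (retr (mat_exp (Z k \<omega>)))" for k \<omega>
  have Z_meas [measurable]: "Z k \<in> borel_measurable (F k)" for k
  proof -
    note [measurable] = Y_meas W_meas
    show ?thesis unfolding Z_def[abs_def] by measurable
  qed
  have Z_sa: "self_adjoint (Z k \<omega>)" if "\<omega> \<in> space M" for k \<omega>
    unfolding Z_def by (intro self_adjoint_diff self_adjoint_scaleR Y_sa that self_adjoint_herm_part)
  have step: "(\<integral>\<^sup>+\<omega>. S (Suc k) \<omega> * indicator D \<omega> \<partial>M) \<le> (\<integral>\<^sup>+\<omega>. S k \<omega> * indicator D \<omega> \<partial>M)"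
    if "D \<in> sets (F k)" for k D
  proof -
    interpret inc: freedman_increment M "F k" "Z k" "X k" R \<theta>
    proof unfold_locales
      have [measurable]: "Y n \<in> borel_measurable M" for n
        using measurable_from_subalg[OF sub Y_meas] .
      show "X k \<in> borel_measurable M" unfolding X_eq[abs_def] by measurable
      show "mat_cond_exp_exists M (F k) (\<lambda>\<omega>. X k \<omega> ** X k \<omega>)"
        using assms(8)[of "Suc k"] by (simp add: X_def)
    qed (use sub Z_meas Z_sa X_sa X_le X_centered R \<theta> \<theta>_less in auto)
    have "Z (Suc k) \<omega> = Z k \<omega> + \<theta> *\<^sub>R X k \<omega> - inc.g *\<^sub>R inc.V \<omega>" for \<omega>
    proof -
      have "W (Suc k) \<omega> = W k \<omega> + mat_cond_exp M (F k) (\<lambda>\<omega>. X k \<omega> ** X k \<omega>) \<omega>"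
        by (simp add: W_def predictable_quad_var_def X_def)
      thus ?thesis
        by (simp add: Z_def X_eq inc.V_def inc.g_def g_def herm_part_add algebra_simps)
    qed
    thus ?thesis using inc.step[OF that] by (simp add: S_def)
  qed
  define l where "l = exp (\<theta> * t - g * \<sigma>\<^sup>2)"
  define A where "A = {\<omega> \<in> space M. \<exists>k. ennreal l \<le> S k \<omega>}"
  have S_meas: "S k \<in> borel_measurable (F k)" for k
    unfolding S_def[abs_def] by measurable
  have "ennreal l * emeasure M A \<le> (\<integral>\<^sup>+\<omega>. S 0 \<omega> \<partial>M)"
    unfolding A_def by (rule supermartingale_maximal_inequality[OF assms(2) sub S_meas step])
  \<comment> \<open>At time 0 both \<open>Y\<close> and the empty sum \<open>W\<close> vanish, so
    the trace is that of the identity.\<close>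
  also have "\<dots> = (\<integral>\<^sup>+\<omega>. ennreal (real CARD('n)) \<partial>M)"
    by (intro nn_integral_cong)
      (simp add: S_def Z_def Y0 W_def predictable_quad_var_def mat_exp_0 retr_mat_1)
  also have "\<dots> = ennreal (real CARD('n))" by (simp add: emeasure_space_1)
  finally have "ennreal (l * measure M A) \<le> ennreal (real CARD('n))"
    by (simp add: emeasure_eq_measure l_def flip: ennreal_mult')
  hence bound: "l * measure M A \<le> real CARD('n)" by (simp add: ennreal_le_iff)
  \<comment> \<open>Monotonicity of the measure is applied with this measurable superset of the
    event in question.\<close>
  have "A \<in> events"
  proof -
    have [measurable]: "S k \<in> borel_measurable M" for k
      using measurable_from_subalg[OF sub S_meas] .
    show ?thesis unfolding A_def by measurable
  qed
  moreover have "{\<omega> \<in> space M. \<exists>k\<ge>0. lambda_max (Y k \<omega>) \<ge> t \<and>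
      spectral_norm (predictable_quad_var M F Y k \<omega>) \<le> \<sigma>\<^sup>2} \<subseteq> A"
  proof safe
    fix \<omega> k
    assume \<omega>: "\<omega> \<in> space M" and tY: "t \<le> lambda_max (Y k \<omega>)"
      and W_le: "spectral_norm (predictable_quad_var M F Y k \<omega>) \<le> \<sigma>\<^sup>2"
    \<comment> \<open>At a unit vector where \<open>Y k\<close> attains its largest eigenvalue, the
      form of \<open>W k\<close> is still at most its spectral norm, so both conditions of the event
      bound the form of \<open>Z k\<close> from below.\<close>
    obtain v where v: "norm v = 1" "qform (Y k \<omega>) v = lambda_max (Y k \<omega>)"
      using lambda_max_attained[OF Y_sa[OF \<omega>, of k]] .
    have "qform (W k \<omega>) v \<le> \<sigma>\<^sup>2"
      using qform_le_spectral_norm[OF v(1), of "W k \<omega>"] W_le by (simp add: W_def)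
    hence "g * qform (W k \<omega>) v \<le> g * \<sigma>\<^sup>2" "\<theta> * t \<le> \<theta> * qform (Y k \<omega>) v"
      using g \<theta> tY v by (auto intro: mult_left_mono)
    hence "\<theta> * t - g * \<sigma>\<^sup>2 \<le> qform (Z k \<omega>) v"
      by (simp add: Z_def qform_diff_mat qform_scaleR_mat qform_herm_part)
    hence "l \<le> retr (mat_exp (Z k \<omega>))"
      unfolding l_def by (intro exp_le_retr_mat_exp[OF Z_sa[OF \<omega>] v(1)])
    thus "\<omega> \<in> A" using \<omega> by (auto simp: A_def S_def intro!: exI[of _ k] ennreal_leI)
  qed
  ultimately have "measure M {\<omega> \<in> space M. \<exists>k\<ge>0. lambda_max (Y k \<omega>) \<ge> t \<and>
      spectral_norm (predictable_quad_var M F Y k \<omega>) \<le> \<sigma>\<^sup>2} \<le> measure M A"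
    by (intro finite_measure_mono)
  also have "\<dots> \<le> real CARD('n) / l"
    using bound by (simp add: l_def field_simps)
  also have "\<dots> = real CARD('n) * exp (- (\<theta> * t - g * \<sigma>\<^sup>2))"
    by (simp only: l_def exp_minus divide_inverse)
  also have "- (\<theta> * t - g * \<sigma>\<^sup>2) = (- t\<^sup>2 / 2) / (\<sigma>\<^sup>2 + R * t / 3)"
    unfolding exponent s_def by simp
  finally show ?thesis .
qed

end
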